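(* Let $\eta_1,\eta_2,\eta_3\in\mathbb{R}$ satisfy $\eta_2<\eta_1<\eta_3$ and $\eta_2+\eta_3>2\eta_1$. Let $\Omega\subset\mathbb{R}^3$ be a bounded, simply connected Lipschitz domain. Let $u\in W^{1,\infty}(\Omega;\mathbb{R}^3)$ satisfy $e(u)\in K_3$ almost everywhere in $\Omega$, and let $e_{11},e_{22},e_{33}:\Omega\to\mathbb{R}$ be the diagonal components of $e(u)$. Then each function $e_{jj}$, $j\in\{1,2,3\}$, is constant (i.e. equal almost everywhere in $\Omega$ to a constant).
   Context: $e(u):=\frac12(\nabla u+(\nabla u)^t)$ denotes the symmetrized gradient. $K_3:=\{e^{(1)},e^{(2)},e^{(3)}\}\subset\mathbb{R}^{3\times3}_{sym}$, where $e^{(1)}=\mathrm{diag}(\eta_3,\eta_1,\eta_2)$, $e^{(2)}=\mathrm{diag}(\eta_2,\eta_3,\eta_1)$, $e^{(3)}=\mathrm{diag}(\eta_1,\eta_2,\eta_3)$. A Lipschitz domain is an open connected set with Lipschitz boundary. *)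

theory Defs
  imports "HOL-Analysis.Analysis"
begin

fun iterated_deriv :: "'a::euclidean_space list \<Rightarrow> ('a \<Rightarrow> real) \<Rightarrow> 'a \<Rightarrow> real" where
  "iterated_deriv [] f = f"
| "iterated_deriv (b # bs) f = (\<lambda>x. frechet_derivative (iterated_deriv bs f) (at x) b)"

(* C-infinity: iterated directional derivatives of every order exist and are (Frechet)
   differentiable.  Since the derivative of every order is again differentiable, it is continuous. *)
definition smooth :: "('a::euclidean_space \<Rightarrow> real) \<Rightarrow> bool" where
  "smooth f \<longleftrightarrow> (\<forall>bs. iterated_deriv bs f differentiable_on UNIV)"

definition test_function :: "'a::euclidean_space set \<Rightarrow> ('a \<Rightarrow> real) \<Rightarrow> bool" where
  "test_function \<Omega> \<phi> \<longleftrightarrow>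
     smooth \<phi> \<and> compact (closure {x. \<phi> x \<noteq> 0}) \<and> closure {x. \<phi> x \<noteq> 0} \<subseteq> \<Omega>"

definition locally_integrable :: "'a::euclidean_space set \<Rightarrow> ('a \<Rightarrow> real) \<Rightarrow> bool" where
  "locally_integrable \<Omega> f \<longleftrightarrow> (\<forall>K. compact K \<and> K \<subseteq> \<Omega> \<longrightarrow> f absolutely_integrable_on K)"

(* g is the distributional derivative of f on \<Omega> in direction b.  Local integrability is part of
   the definition because the Bochner integral of a non-integrable function is 0 by convention. *)
definition has_weak_derivative ::
  "'a::euclidean_space set \<Rightarrow> ('a \<Rightarrow> real) \<Rightarrow> 'a \<Rightarrow> ('a \<Rightarrow> real) \<Rightarrow> bool" where
  "has_weak_derivative \<Omega> f b g \<longleftrightarrow>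
     locally_integrable \<Omega> f \<and> locally_integrable \<Omega> g \<and>
     (\<forall>\<phi>. test_function \<Omega> \<phi> \<longrightarrow>
        (LINT x|lebesgue_on \<Omega>. f x * frechet_derivative \<phi> (at x) b)
          = - (LINT x|lebesgue_on \<Omega>. g x * \<phi> x))"

(* Row i of Du x is the gradient of the i-th component of u. *)
definition has_weak_gradient ::
  "(real^'n) set \<Rightarrow> (real^'n \<Rightarrow> real^'m) \<Rightarrow> (real^'n \<Rightarrow> real^'n^'m) \<Rightarrow> bool" where
  "has_weak_gradient \<Omega> u Du \<longleftrightarrow>
     (\<forall>i j. has_weak_derivative \<Omega> (\<lambda>x. u x $ i) (axis j 1) (\<lambda>x. Du x $ i $ j))"

definition L_infinity :: "'a::euclidean_space set \<Rightarrow> ('a \<Rightarrow> 'b::euclidean_space) set" where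
  "L_infinity \<Omega> =
     {f \<in> borel_measurable (lebesgue_on \<Omega>). \<exists>C. AE x in lebesgue_on \<Omega>. norm (f x) \<le> C}"

definition W1_infinity :: "(real^'n) set \<Rightarrow> (real^'n \<Rightarrow> real^'m) set" where
  "W1_infinity \<Omega> = {u \<in> L_infinity \<Omega>. \<exists>Du \<in> L_infinity \<Omega>. has_weak_gradient \<Omega> u Du}"

(* Near each boundary point, \<Omega> is the strict epigraph, in direction \<nu>, of a Lipschitz function g
   on the hyperplane orthogonal to \<nu>; y - (y \<bullet> \<nu>) *\<^sub>R \<nu> is the projection of y to that hyperplane. *)
definition lipschitz_boundary :: "'a::euclidean_space set \<Rightarrow> bool" where
  "lipschitz_boundary \<Omega> \<longleftrightarrow>
     (\<forall>x \<in> frontier \<Omega>. \<exists>r > 0. \<exists>\<nu> L. \<exists>g :: 'a \<Rightarrow> real.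
        norm \<nu> = 1 \<and> L-lipschitz_on {z. z \<bullet> \<nu> = 0} g \<and>
        \<Omega> \<inter> ball x r = {y \<in> ball x r. g (y - (y \<bullet> \<nu>) *\<^sub>R \<nu>) < y \<bullet> \<nu>})"

definition lipschitz_domain :: "'a::euclidean_space set \<Rightarrow> bool" where
  "lipschitz_domain \<Omega> \<longleftrightarrow> open \<Omega> \<and> connected \<Omega> \<and> lipschitz_boundary \<Omega>"

definition sym_part :: "real^'n^'n \<Rightarrow> real^'n^'n" where
  "sym_part A = (1/2) *\<^sub>R (A + transpose A)"

definition diag_matrix :: "real^'n \<Rightarrow> real^'n^'n" where
  "diag_matrix v = (\<chi> i j. if i = j then v $ i else 0)"

definition K3 :: "real \<Rightarrow> real \<Rightarrow> real \<Rightarrow> (real^3^3) set" where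
  "K3 \<eta>1 \<eta>2 \<eta>3 =
     {diag_matrix (vector [\<eta>3, \<eta>1, \<eta>2]),
      diag_matrix (vector [\<eta>2, \<eta>3, \<eta>1]),
      diag_matrix (vector [\<eta>1, \<eta>2, \<eta>3])}"

end

theory Submission
  imports Defs
begin

text \<open>
  Write \<open>e\<^sub>1, e\<^sub>2, e\<^sub>3\<close> for the diagonal strain components; the off-diagonal ones vanish.  The
  Saint-Venant compatibility conditions then read \<open>\<partial>\<^sub>j \<partial>\<^sub>k e\<^sub>i = 0\<close> for distinct indices and
  \<open>\<partial>\<^sub>j \<partial>\<^sub>j e\<^sub>i = - \<partial>\<^sub>i \<partial>\<^sub>i e\<^sub>j\<close> in the sense of distributions (lemma \<open>saint_venant\<close>).  All three wells
  have the same trace, so adding up the second family gives the wave equation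
  \<open>(\<partial>\<^sub>1 \<partial>\<^sub>1 - \<partial>\<^sub>2 \<partial>\<^sub>2 - \<partial>\<^sub>3 \<partial>\<^sub>3) e\<^sub>1 = 0\<close>; together with \<open>\<partial>\<^sub>2 \<partial>\<^sub>3 e\<^sub>1 = 0\<close> it factors into
  \<open>\<partial>\<^sub>v \<partial>\<^sub>w e\<^sub>1 = 0\<close> for \<open>v = (1, 1, 1)\<close> and \<open>w = (1, -1, -1)\<close>.

  An equation \<open>\<partial>\<^sub>v \<partial>\<^sub>w f = 0\<close> says that \<open>f\<close> satisfies the parallelogram identity
  \<open>f x + f (x + v + w) = f (x + v) + f (x + w)\<close> for almost every \<open>x\<close> (lemma \<open>second_difference\<close>).
  This is where the assumption on the three numbers enters.  Since \<open>\<eta>2 < \<eta>1 < \<eta>3\<close> and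
  \<open>\<eta>2 + \<eta>3 \<noteq> 2 * \<eta>1\<close>, they form a Sidon set: a sum of two of them determines the two summands.
  Hence on every such parallelogram the two diagonals carry the same pair of values
  (lemma \<open>sidon_triple\<close>).  Moreover each single \<open>e\<^sub>i\<close> determines the well, so the identities for
  \<open>e\<^sub>2\<close> and \<open>e\<^sub>3\<close> constrain \<open>e\<^sub>1\<close> as well.

  The rest is combinatorics on a grid of 27 points around a generic point.  The identities in the
  three coordinate planes force \<open>e\<^sub>1\<close> to depend on a single coordinate, and the parallelogram spanned
  by \<open>v\<close> and \<open>w\<close> then makes it constant (lemma \<open>grid_rigidity\<close>).  So \<open>e\<^sub>1\<close> is invariant under small
  shifts along the axes, hence locally constant almost everywhere, hence constant since the domain
  is connected; and \<open>e\<^sub>1\<close> determines the other two components.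
\<close>

section \<open>Smooth functions\<close>

abbreviation dderiv :: "'a::euclidean_space \<Rightarrow> ('a \<Rightarrow> real) \<Rightarrow> 'a \<Rightarrow> real" where
  "dderiv b f \<equiv> (\<lambda>x. frechet_derivative f (at x) b)"

lemma iterated_deriv_snoc: "iterated_deriv (bs @ [b]) f = iterated_deriv bs (dderiv b f)"
  by (induction bs) auto

lemma smooth_imp_differentiable: "smooth f \<Longrightarrow> f differentiable_on UNIV"
  unfolding smooth_def by (metis iterated_deriv.simps(1))

lemma smooth_has_derivative:
  "smooth f \<Longrightarrow> (f has_derivative frechet_derivative f (at x)) (at x)"
  using smooth_imp_differentiable[of f]
  by (simp add: differentiable_on_def frechet_derivative_works)

lemma smooth_dderiv: "smooth f \<Longrightarrow> smooth (dderiv b f)"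
  unfolding smooth_def by (metis iterated_deriv_snoc)

lemma smooth_continuous: "smooth f \<Longrightarrow> continuous_on UNIV f"
  by (simp add: differentiable_imp_continuous_on smooth_imp_differentiable)

text \<open>
  Coinduction turns smoothness, which speaks of derivatives of every order, into a closure property:
  a class of differentiable functions that is closed under directional derivatives is smooth.
\<close>
lemma smooth_coinduct:
  assumes "P f"
    and step: "\<And>f. P f \<Longrightarrow> f differentiable_on UNIV \<and> (\<forall>b. P (dderiv b f))"
  shows "smooth f"
proof -
  have "P (iterated_deriv bs f)" for bs
    by (induction bs) (use assms in auto)
  then show ?thesis
    using step by (auto simp: smooth_def)
qed

lemma dderiv_eqI: "(f has_derivative f') (at x) \<Longrightarrow> dderiv b f x = f' b"
  by (metis frechet_derivative_at)

lemma smooth_const: "smooth (\<lambda>x. c)"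
proof (rule smooth_coinduct[where P = "\<lambda>f. \<exists>c. f = (\<lambda>x. c)"])
  fix f :: "'a \<Rightarrow> real" assume "\<exists>c. f = (\<lambda>x. c)"
  then show "f differentiable_on UNIV \<and> (\<forall>b. \<exists>c. dderiv b f = (\<lambda>x. c))"
    by auto
qed auto

lemma dderiv_translate:
  assumes "smooth f"
  shows "(\<lambda>x. f (x - v)) differentiable_on UNIV"
    and "dderiv b (\<lambda>x. f (x - v)) = (\<lambda>x. dderiv b f (x - v))"
proof -
  have D: "((\<lambda>x. f (x - v)) has_derivative frechet_derivative f (at (x - v))) (at x)" for x
    by (rule has_derivative_compose[OF _ smooth_has_derivative[OF assms]])
       (auto intro!: derivative_eq_intros)
  then show "(\<lambda>x. f (x - v)) differentiable_on UNIV"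
    by (auto simp: differentiable_on_def differentiable_def)
  show "dderiv b (\<lambda>x. f (x - v)) = (\<lambda>x. dderiv b f (x - v))"
    by (rule ext) (rule dderiv_eqI[OF D])
qed

lemma smooth_translate:
  assumes "smooth f" shows "smooth (\<lambda>x. f (x - v))"
proof (rule smooth_coinduct[where P = "\<lambda>g. \<exists>f. smooth f \<and> g = (\<lambda>x. f (x - v))"])
  fix g :: "'a \<Rightarrow> real" assume "\<exists>f. smooth f \<and> g = (\<lambda>x. f (x - v))"
  then obtain f where f: "smooth f" and g: "g = (\<lambda>x. f (x - v))" by blast
  show "g differentiable_on UNIV \<and> (\<forall>b. \<exists>f. smooth f \<and> dderiv b g = (\<lambda>x. f (x - v)))"
    unfolding g dderiv_translate(2)[OF f]
  proof (intro conjI allI dderiv_translate(1)[OF f])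
    fix b show "\<exists>h. smooth h \<and> (\<lambda>x. dderiv b f (x - v)) = (\<lambda>x. h (x - v))"
      by (intro exI[of _ "dderiv b f"] conjI smooth_dderiv f refl)
  qed
qed (use assms in blast)

text \<open>
  For \<open>k = 0\<close> this is the standard smooth function that is positive exactly on the positive
  half-line.  The extra factor makes the derivatives of members of the family expressible by members.
\<close>
definition flat :: "nat \<Rightarrow> real \<Rightarrow> real" where
  "flat k t = (if t > 0 then (1 / t) ^ k * exp (- (1 / t)) else 0)"

lemma flat_tendsto_0: "(flat k \<longlongrightarrow> 0) (at 0)"
proof -
  have "((\<lambda>t::real. (1 / t) ^ k / exp (1 / t)) \<longlongrightarrow> 0) (at_right 0)"
    by (rule filterlim_compose[OF tendsto_power_div_exp_0])
       (simp add: divide_inverse filterlim_inverse_at_top_right)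
  moreover have "eventually (\<lambda>t. (1 / t) ^ k / exp (1 / t) = flat k t) (at_right 0)"
    by (rule eventually_at_rightI[of 0 1]) (auto simp: flat_def exp_minus divide_inverse)
  ultimately have R: "(flat k \<longlongrightarrow> 0) (at_right 0)"
    by (rule Lim_transform_eventually)
  have "eventually (\<lambda>t. 0 = flat k t) (at_left 0)"
    by (rule eventually_at_leftI[of "-1" 0]) (auto simp: flat_def)
  then have L: "(flat k \<longlongrightarrow> 0) (at_left 0)"
    by (rule Lim_transform_eventually[OF tendsto_const])
  show ?thesis
    using L R filterlim_split_at by blast
qed

lemma flat_has_derivative:
  "(flat k has_real_derivative flat (k + 2) t - real k * flat (k + 1) t) (at t)"
proof -
  consider "t > 0" | "t < 0" | "t = 0" by linarith
  then show ?thesis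
  proof cases
    case 1
    have D: "((\<lambda>t. 1 / t) has_real_derivative (- ((1 / t) ^ 2))) (at t)"
      using 1 by (auto intro!: derivative_eq_intros simp: power2_eq_square)
    have "((\<lambda>t. (1 / t) ^ k * exp (- (1 / t))) has_real_derivative flat (k + 2) t - real k * flat (k + 1) t) (at t)"
      by (rule DERIV_cong[OF DERIV_mult[OF DERIV_power[OF D] DERIV_fun_exp[OF DERIV_minus[OF D]]]])
         (use 1 in \<open>cases k; simp add: flat_def algebra_simps power2_eq_square\<close>)
    moreover have "\<forall>\<^sub>F s in nhds t. (1 / s) ^ k * exp (- (1 / s)) = flat k s"
      using 1 eventually_nhds_in_open[of "{0<..}" t]
      by (auto simp: flat_def elim: eventually_mono)
    ultimately show ?thesis using DERIV_cong_ev[OF refl _ refl] by fast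
  next
    case 2
    have "\<forall>\<^sub>F s in nhds t. 0 = flat k s"
      using 2 eventually_nhds_in_open[of "{..<0}" t]
      by (auto simp: flat_def elim: eventually_mono)
    moreover have "((\<lambda>t. 0) has_real_derivative flat (k + 2) t - real k * flat (k + 1) t) (at t)"
      using 2 by (auto simp: flat_def)
    ultimately show ?thesis using DERIV_cong_ev[OF refl _ refl] by fast
  next
    case 3
    have "flat (Suc k) s = (flat k s - flat k 0) / (s - 0)" for s
      by (simp add: flat_def)
    then have "((\<lambda>s. (flat k s - flat k 0) / (s - 0)) \<longlongrightarrow> 0) (at 0)"
      using flat_tendsto_0[of "Suc k"] by presburger
    then have "(flat k has_real_derivative 0) (at 0)"
      by (simp add: has_field_derivative_iff)
    then show ?thesis using 3 by (simp add: flat_def)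
  qed
qed

text \<open>
  Smoothness of sums, products and of the functions \<open>flat k\<close> is proved in one go: derivatives of these
  are again sums and products of functions of the same kind, so the class that they generate is
  closed under directional derivatives and \<open>smooth_coinduct\<close> applies.
\<close>
inductive_set smooth_algebra :: "('a::euclidean_space \<Rightarrow> real) set" where
  base: "smooth f \<Longrightarrow> f \<in> smooth_algebra"
| flat: "(\<lambda>x. flat k (x \<bullet> b + d)) \<in> smooth_algebra"
| add: "f \<in> smooth_algebra \<Longrightarrow> g \<in> smooth_algebra \<Longrightarrow> (\<lambda>x. f x + g x) \<in> smooth_algebra"
| mult: "f \<in> smooth_algebra \<Longrightarrow> g \<in> smooth_algebra \<Longrightarrow> (\<lambda>x. f x * g x) \<in> smooth_algebra"

lemma smooth_algebra_smooth:
  assumes "f \<in> smooth_algebra" shows "smooth f"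
proof (rule smooth_coinduct[where P = "\<lambda>f. f \<in> smooth_algebra", OF assms])
  fix f :: "'a \<Rightarrow> real" assume "f \<in> smooth_algebra"
  then show "f differentiable_on UNIV \<and> (\<forall>b. dderiv b f \<in> smooth_algebra)"
  proof induction
    case (base f)
    then show ?case
      by (simp add: smooth_algebra.base smooth_dderiv smooth_imp_differentiable)
  next
    case (flat k b d)
    have D: "((\<lambda>x. flat k (x \<bullet> b + d)) has_derivative
        (\<lambda>h. (flat (k + 2) (x \<bullet> b + d) - real k * flat (k + 1) (x \<bullet> b + d)) * (h \<bullet> b))) (at x)" for x
      by (rule has_derivative_compose[of "\<lambda>x. x \<bullet> b + d" "\<lambda>h. h \<bullet> b" _ _ "flat k", OF _ flat_has_derivative[unfolded has_field_derivative_def]])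
         (auto intro!: derivative_eq_intros)
    have "dderiv e (\<lambda>x. flat k (x \<bullet> b + d)) \<in> smooth_algebra" for e
    proof -
      have "dderiv e (\<lambda>x. flat k (x \<bullet> b + d)) =
        (\<lambda>x. (flat (k + 2) (x \<bullet> b + d) + (- real k) * flat (k + 1) (x \<bullet> b + d)) * (e \<bullet> b))"
        using dderiv_eqI[OF D] by (simp add: fun_eq_iff)
      also have "\<dots> \<in> smooth_algebra"
        by (intro smooth_algebra.intros smooth_const)
      finally show ?thesis .
    qed
    moreover have "(\<lambda>x. flat k (x \<bullet> b + d)) differentiable_on UNIV"
      using D by (auto simp: differentiable_on_def differentiable_def)
    ultimately show ?case by blast
  next
    case (add f g)
    have D: "(f has_derivative frechet_derivative f (at x)) (at x)"
            "(g has_derivative frechet_derivative g (at x)) (at x)" for x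
      using add by (auto simp: differentiable_on_def frechet_derivative_works)
    have "dderiv b (\<lambda>x. f x + g x) = (\<lambda>x. dderiv b f x + dderiv b g x)" for b
      using dderiv_eqI[OF has_derivative_add[OF D]] by blast
    then show ?case using add by (auto intro: smooth_algebra.add)
  next
    case (mult f g)
    have D: "(f has_derivative frechet_derivative f (at x)) (at x)"
            "(g has_derivative frechet_derivative g (at x)) (at x)" for x
      using mult by (auto simp: differentiable_on_def frechet_derivative_works)
    have "dderiv b (\<lambda>x. f x * g x) = (\<lambda>x. f x * dderiv b g x + dderiv b f x * g x)" for b
      using dderiv_eqI[OF has_derivative_mult[OF D]] by blast
    moreover have "(\<lambda>x. f x * dderiv b g x + dderiv b f x * g x) \<in> smooth_algebra" for b
      by (intro smooth_algebra.add smooth_algebra.mult) (use mult in auto)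
    ultimately show ?case using mult by auto
  qed
qed

lemma smooth_mult: "smooth f \<Longrightarrow> smooth g \<Longrightarrow> smooth (\<lambda>x. f x * g x)"
  by (rule smooth_algebra_smooth[OF smooth_algebra.mult[OF smooth_algebra.base smooth_algebra.base]])

lemma smooth_flat: "smooth (\<lambda>x. flat k (x \<bullet> b + d))"
  by (rule smooth_algebra_smooth[OF smooth_algebra.flat])

lemma smooth_prod: "(\<And>i. i \<in> I \<Longrightarrow> smooth (f i)) \<Longrightarrow> smooth (\<lambda>x. \<Prod>i\<in>I. f i x)"
  by (induction I rule: infinite_finite_induct) (auto intro: smooth_const smooth_mult)

lemma smooth_has_derivative_along_line:
  assumes "smooth f"
  shows "((\<lambda>s. f (x + s *\<^sub>R v)) has_real_derivative dderiv v f (x + s *\<^sub>R v)) (at s within S)"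
proof -
  have "((\<lambda>s. f (x + s *\<^sub>R v)) has_derivative (\<lambda>h. frechet_derivative f (at (x + s *\<^sub>R v)) (h *\<^sub>R v))) (at s within S)"
    by (rule has_derivative_compose[OF _ smooth_has_derivative[OF assms]])
       (auto intro!: derivative_eq_intros)
  moreover have "frechet_derivative f (at y) (h *\<^sub>R v) = dderiv v f y * h" for h y
    using smooth_has_derivative[OF assms, of y]
    by (simp add: bounded_linear.linear has_derivative_bounded_linear linear_cmul)
  ultimately show ?thesis by (simp add: has_field_derivative_def)
qed

text \<open>
  The mean value theorem, applied once in each direction.  The left-hand side is symmetric in
  \<open>v\<close> and \<open>w\<close>, the right-hand side is not; letting \<open>h\<close> tend to 0 gives the symmetry of second
  derivatives.
\<close>
lemma second_difference_mean_value:
  assumes f: "smooth f" and h: "h > 0"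
  shows "\<exists>p. norm (p - x) \<le> h * (norm v + norm w) \<and>
      f (x + h *\<^sub>R v + h *\<^sub>R w) - f (x + h *\<^sub>R w) - f (x + h *\<^sub>R v) + f x
      = h * h * dderiv w (dderiv v f) p"
proof -
  let ?g = "\<lambda>s. f ((x + h *\<^sub>R w) + s *\<^sub>R v) - f (x + s *\<^sub>R v)"
  have "(?g has_real_derivative
      dderiv v f ((x + h *\<^sub>R w) + s *\<^sub>R v) - dderiv v f (x + s *\<^sub>R v)) (at s)" for s
    by (intro DERIV_diff smooth_has_derivative_along_line f)
  then obtain s where s: "0 < s" "s < h" "?g h - ?g 0 =
      (h - 0) * (dderiv v f ((x + h *\<^sub>R w) + s *\<^sub>R v) - dderiv v f (x + s *\<^sub>R v))"
    using MVT2[OF h, of ?g "\<lambda>s. dderiv v f ((x + h *\<^sub>R w) + s *\<^sub>R v) - dderiv v f (x + s *\<^sub>R v)"]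
    by meson
  let ?k = "\<lambda>t. dderiv v f ((x + s *\<^sub>R v) + t *\<^sub>R w)"
  have "(?k has_real_derivative dderiv w (dderiv v f) ((x + s *\<^sub>R v) + t *\<^sub>R w)) (at t)" for t
    by (intro smooth_has_derivative_along_line smooth_dderiv f)
  then obtain t where t: "0 < t" "t < h"
    "?k h - ?k 0 = (h - 0) * dderiv w (dderiv v f) ((x + s *\<^sub>R v) + t *\<^sub>R w)"
    using MVT2[OF h, of ?k "\<lambda>t. dderiv w (dderiv v f) ((x + s *\<^sub>R v) + t *\<^sub>R w)"]
    by meson
  let ?p = "x + s *\<^sub>R v + t *\<^sub>R w"
  have "norm (?p - x) \<le> norm (s *\<^sub>R v) + norm (t *\<^sub>R w)"
    using norm_triangle_ineq[of "s *\<^sub>R v" "t *\<^sub>R w"] by (simp add: add.assoc)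
  also have "\<dots> \<le> h * norm v + h * norm w"
    using s t by (intro add_mono) (auto intro!: mult_right_mono)
  finally have 1: "norm (?p - x) \<le> h * (norm v + norm w)" by (simp add: distrib_left)
  have "f (x + h *\<^sub>R v + h *\<^sub>R w) - f (x + h *\<^sub>R w) - f (x + h *\<^sub>R v) + f x = ?g h - ?g 0"
    by (simp add: add.assoc add.commute[of "h *\<^sub>R v"])
  also have "\<dots> = h * (?k h - ?k 0)"
    unfolding s(3) by (simp add: add.assoc add.commute[of "h *\<^sub>R w"])
  also have "\<dots> = h * h * dderiv w (dderiv v f) ?p"
    unfolding t(3) by simp
  finally show ?thesis using 1 by blast
qed

lemma dderiv_commute:
  assumes f: "smooth f"
  shows "dderiv v (dderiv w f) x = dderiv w (dderiv v f) x"
proof -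
  let ?h = "\<lambda>n. inverse (real (Suc n))"
  have "\<exists>p. norm (p - x) \<le> ?h n * (norm v + norm w) \<and>
      f (x + ?h n *\<^sub>R v + ?h n *\<^sub>R w) - f (x + ?h n *\<^sub>R w) - f (x + ?h n *\<^sub>R v) + f x
      = ?h n * ?h n * dderiv w (dderiv v f) p" for n
    by (rule second_difference_mean_value[OF f]) simp
  then obtain p where p: "\<And>n. norm (p n - x) \<le> ?h n * (norm v + norm w)"
     "\<And>n. f (x + ?h n *\<^sub>R v + ?h n *\<^sub>R w) - f (x + ?h n *\<^sub>R w) - f (x + ?h n *\<^sub>R v) + f x
      = ?h n * ?h n * dderiv w (dderiv v f) (p n)"
    by meson
  have "\<exists>p. norm (p - x) \<le> ?h n * (norm w + norm v) \<and>
      f (x + ?h n *\<^sub>R w + ?h n *\<^sub>R v) - f (x + ?h n *\<^sub>R v) - f (x + ?h n *\<^sub>R w) + f x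
      = ?h n * ?h n * dderiv v (dderiv w f) p" for n
    by (rule second_difference_mean_value[OF f]) simp
  then obtain q where q: "\<And>n. norm (q n - x) \<le> ?h n * (norm w + norm v)"
     "\<And>n. f (x + ?h n *\<^sub>R w + ?h n *\<^sub>R v) - f (x + ?h n *\<^sub>R v) - f (x + ?h n *\<^sub>R w) + f x
      = ?h n * ?h n * dderiv v (dderiv w f) (q n)"
    by meson
  have eq: "dderiv w (dderiv v f) (p n) = dderiv v (dderiv w f) (q n)" for n
  proof -
    have "?h n * ?h n * dderiv w (dderiv v f) (p n) = ?h n * ?h n * dderiv v (dderiv w f) (q n)"
      unfolding p(2)[symmetric] q(2)[symmetric] by (simp add: add.commute add.left_commute)
    then show ?thesis by simp
  qed
  have lim: "r \<longlonglongrightarrow> x" if "\<And>n. norm (r n - x) \<le> ?h n * c" for r c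
  proof -
    have "(\<lambda>n. ?h n * c) \<longlonglongrightarrow> 0 * c"
      by (intro tendsto_intros LIMSEQ_inverse_real_of_nat)
    then have "(\<lambda>n. ?h n * c) \<longlonglongrightarrow> 0"
      by (simp only: mult_zero_left)
    moreover have "\<forall>\<^sub>F n in sequentially. norm (r n - x) \<le> ?h n * c"
      using that by (rule always_eventually[OF allI])
    ultimately have "(\<lambda>n. r n - x) \<longlonglongrightarrow> 0"
      by (rule Lim_null_comparison[rotated])
    then show ?thesis by (simp add: LIM_zero_iff)
  qed
  have cont: "isCont (dderiv a (dderiv b f)) x" for a b
    using smooth_continuous[OF smooth_dderiv[OF smooth_dderiv[OF f]]]
    by (simp add: continuous_on_eq_continuous_at)
  have "(\<lambda>n. dderiv w (dderiv v f) (p n)) \<longlonglongrightarrow> dderiv w (dderiv v f) x"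
    by (rule isCont_tendsto_compose[OF cont lim[OF p(1)]])
  moreover have "(\<lambda>n. dderiv v (dderiv w f) (q n)) \<longlonglongrightarrow> dderiv v (dderiv w f) x"
    by (rule isCont_tendsto_compose[OF cont lim[OF q(1)]])
  ultimately show ?thesis
    unfolding eq by (rule LIMSEQ_unique[rotated])
qed

section \<open>Test functions\<close>

lemma test_functionI:
  assumes "smooth \<phi>" "compact K" "K \<subseteq> \<Omega>" "\<And>x. x \<notin> K \<Longrightarrow> \<phi> x = 0"
  shows "test_function \<Omega> \<phi>"
proof -
  have "closure {x. \<phi> x \<noteq> 0} \<subseteq> K"
    using assms by (intro closure_minimal compact_imp_closed) auto
  moreover from this have "compact (closure {x. \<phi> x \<noteq> 0})"
    using assms(2) compact_Int_closed[OF assms(2) closed_closure] by (metis Int_absorb1)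
  ultimately show ?thesis
    unfolding test_function_def using assms(1,3) by auto
qed

lemma test_function_support:
  assumes "test_function \<Omega> \<phi>"
  shows "\<exists>K. smooth \<phi> \<and> compact K \<and> K \<subseteq> \<Omega> \<and> (\<forall>x. x \<notin> K \<longrightarrow> \<phi> x = 0) \<and>
    (\<forall>b x. x \<notin> K \<longrightarrow> dderiv b \<phi> x = 0)"
proof -
  let ?K = "closure {x. \<phi> x \<noteq> 0}"
  have z: "\<phi> x = 0" if "x \<notin> ?K" for x
    using that closure_subset[of "{x. \<phi> x \<noteq> 0}"] by auto
  have d: "dderiv b \<phi> x = 0" if "x \<notin> ?K" for b x
  proof -
    have "(\<phi> has_derivative (\<lambda>h. 0)) (at x)"
    proof (rule has_derivative_transform_within_open[where s = "- ?K" and f = "\<lambda>_. 0"])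
      show "x \<in> - ?K" using that by simp
      show "0 = \<phi> y" if "y \<in> - ?K" for y
        using z[of y] that by simp
    qed auto
    then show ?thesis by (rule dderiv_eqI)
  qed
  have "smooth \<phi>" "compact ?K" "?K \<subseteq> \<Omega>"
    using assms unfolding test_function_def by blast+
  then show ?thesis using z d by blast
qed

lemma test_function_dderiv:
  assumes "test_function \<Omega> \<phi>" shows "test_function \<Omega> (dderiv b \<phi>)"
proof -
  from assms obtain K where K: "smooth \<phi>" "compact K" "K \<subseteq> \<Omega>"
      "\<And>x. x \<notin> K \<Longrightarrow> \<phi> x = 0" "\<And>b x. x \<notin> K \<Longrightarrow> dderiv b \<phi> x = 0"
    using test_function_support by metis
  show ?thesis
    by (rule test_functionI[OF smooth_dderiv[OF K(1)] K(2,3,5)])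
qed

lemma test_function_mono: "test_function A \<phi> \<Longrightarrow> A \<subseteq> B \<Longrightarrow> test_function B \<phi>"
  by (auto simp: test_function_def)

lemma test_function_smooth: "test_function A \<phi> \<Longrightarrow> smooth \<phi>"
  by (auto simp: test_function_def)

lemma test_function_measurable: "test_function A \<phi> \<Longrightarrow> \<phi> \<in> borel_measurable borel"
  by (intro borel_measurable_continuous_onI smooth_continuous test_function_smooth)

lemma test_function_bounded:
  assumes "test_function \<Omega> \<phi>" shows "\<exists>C\<ge>0. \<forall>x. \<bar>\<phi> x\<bar> \<le> C"
proof -
  from assms obtain K where K: "smooth \<phi>" "compact K" "K \<subseteq> \<Omega>"
      "\<And>x. x \<notin> K \<Longrightarrow> \<phi> x = 0" "\<And>b x. x \<notin> K \<Longrightarrow> dderiv b \<phi> x = 0"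
    using test_function_support by metis
  then have "compact (\<phi> ` K)"
    by (meson compact_continuous_image continuous_on_subset smooth_continuous subset_UNIV)
  then obtain C where C: "\<And>x. x \<in> K \<Longrightarrow> \<bar>\<phi> x\<bar> \<le> C"
    using compact_imp_bounded bounded_iff by (metis imageI real_norm_def)
  have "\<bar>\<phi> x\<bar> \<le> max C 0" for x
    using C[of x] K(4)[of x] by (cases "x \<in> K") auto
  then show ?thesis by (intro exI[of _ "max C 0"]) auto
qed

lemma test_function_translate:
  assumes "test_function \<Omega> \<phi>"
  shows "test_function ((+) v ` \<Omega>) (\<lambda>x. \<phi> (x - v))"
proof -
  from assms obtain K where K: "smooth \<phi>" "compact K" "K \<subseteq> \<Omega>"
      "\<And>x. x \<notin> K \<Longrightarrow> \<phi> x = 0" "\<And>b x. x \<notin> K \<Longrightarrow> dderiv b \<phi> x = 0"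
    using test_function_support by metis
  show ?thesis
  proof (rule test_functionI)
    show "compact ((+) v ` K)" using K(2) by (rule compact_translation)
    show "\<phi> (x - v) = 0" if "x \<notin> (+) v ` K" for x
      using K(4)[of "x - v"] that by force
  qed (use K smooth_translate in auto)
qed

section \<open>Increments of test functions\<close>

lemma integrable_mult_bounded:
  fixes F G :: "'a::euclidean_space \<Rightarrow> real"
  assumes "integrable lborel F" "G \<in> borel_measurable borel" "\<And>x. \<bar>G x\<bar> \<le> C"
  shows "integrable lborel (\<lambda>x. F x * G x)"
proof (rule Bochner_Integration.integrable_bound)
  show "integrable lborel (\<lambda>x. C * F x)" using assms by simp
  show "AE x in lborel. norm (F x * G x) \<le> norm (C * F x)"
  proof (rule AE_I2)
    fix x
    have "\<bar>F x\<bar> * \<bar>G x\<bar> \<le> \<bar>F x\<bar> * \<bar>C\<bar>"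
      using assms(3)[of x] by (intro mult_left_mono) auto
    then show "norm (F x * G x) \<le> norm (C * F x)" by (simp add: abs_mult mult.commute)
  qed
qed (use assms in simp)

lemma integrable_test_function:
  assumes "integrable lborel F" "test_function \<Omega> \<phi>"
  shows "integrable lborel (\<lambda>x. F x * \<phi> (x - v))"
proof -
  from assms(2) obtain C where C: "\<And>x. \<bar>\<phi> x\<bar> \<le> C" "0 \<le> C"
    using test_function_bounded by metis
  show ?thesis
  proof (rule integrable_mult_bounded[OF assms(1)])
    show "(\<lambda>x. \<phi> (x - v)) \<in> borel_measurable borel"
      using test_function_measurable[OF assms(2)] by measurable
  qed (rule C(1))
qed

lemma integral_lborel_translate:
  fixes f :: "'a::euclidean_space \<Rightarrow> real"
  assumes "f \<in> borel_measurable borel"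
  shows "(LINT x|lborel. f (v + x)) = (LINT x|lborel. f x)"
proof -
  have "(LINT x|lborel. f x) = (LINT x|distr lborel borel ((+) v). f x)"
    by (simp add: lborel_distr_plus)
  also have "\<dots> = (LINT x|lborel. f (v + x))"
    by (rule integral_distr) (use assms in auto)
  finally show ?thesis by simp
qed

lemma test_function_increment:
  assumes "test_function \<Omega> \<psi>"
  shows "\<psi> x - \<psi> (x - v) = (LINT s|lborel. indicator {0..1} s * dderiv v \<psi> (x - s *\<^sub>R v))"
proof -
  have sm: "smooth \<psi>" using assms by (rule test_function_smooth)
  have "((\<lambda>s. - \<psi> (x + s *\<^sub>R (- v))) has_vector_derivative dderiv v \<psi> (x - s *\<^sub>R v)) (at s within {0..1})" for s
  proof -
    have "dderiv (- v) \<psi> y = - dderiv v \<psi> y" for y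
      using smooth_has_derivative[OF sm, of y]
      by (simp add: bounded_linear.linear has_derivative_bounded_linear linear_neg)
    then show ?thesis
      using DERIV_minus[OF smooth_has_derivative_along_line[OF sm, of x "- v" s "{0..1}"]]
      by (simp add: has_real_derivative_iff_has_vector_derivative)
  qed
  moreover have "continuous_on {0..1} (\<lambda>s. dderiv v \<psi> (x - s *\<^sub>R v))"
    by (rule continuous_on_compose2[OF smooth_continuous[OF smooth_dderiv[OF sm]]])
       (auto intro!: continuous_intros)
  ultimately have "(LINT s|lborel. indicator {0..1} s *\<^sub>R dderiv v \<psi> (x - s *\<^sub>R v))
      = - \<psi> (x + 1 *\<^sub>R (- v)) - - \<psi> (x + 0 *\<^sub>R (- v))"
    by (intro integral_FTC_atLeastAtMost) auto
  then show ?thesis by simp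
qed

text \<open>
  The fundamental theorem of calculus along the segment from \<open>x - v\<close> to \<open>x\<close>, integrated against \<open>F\<close>.
  Fubini applies because \<open>F\<close> is integrable and derivatives of test functions are bounded.
\<close>
lemma integral_increment:
  assumes F: "integrable lborel F" and \<psi>: "test_function \<Omega> \<psi>"
  shows "(LINT x|lborel. F x * \<psi> x) - (LINT x|lborel. F x * \<psi> (x - v))
    = (LINT s|lborel. indicator {0..1} s * (LINT x|lborel. F x * dderiv v \<psi> (x - s *\<^sub>R v)))"
proof -
  let ?D = "dderiv v \<psi>"
  note D = test_function_dderiv[OF \<psi>, of v]
  from D obtain C where C: "\<And>x. \<bar>?D x\<bar> \<le> C" "0 \<le> C" using test_function_bounded by metis
  have [measurable]: "?D \<in> borel_measurable borel" using D by (rule test_function_measurable)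
  have [measurable]: "F \<in> borel_measurable borel" using F by simp
  let ?H = "\<lambda>(x, s). F x * (indicator {0..1} s * ?D (x - s *\<^sub>R v))"
  have int: "integrable (lborel \<Otimes>\<^sub>M lborel) ?H"
  proof (rule Bochner_Integration.integrable_bound)
    show "integrable (lborel \<Otimes>\<^sub>M lborel) (\<lambda>(x, s). F x * (C * indicator {0..1::real} s))"
    proof (rule lborel_pair.Fubini_integrable)
      show "integrable lborel (\<lambda>x. \<integral> s. norm (case (x, s) of (x, s) \<Rightarrow> F x * (C * indicator {0..1::real} s)) \<partial>lborel)"
        using F by (simp add: abs_mult)
      show "AE x in lborel. integrable lborel (\<lambda>s. case (x, s) of (x, s) \<Rightarrow> F x * (C * indicator {0..1::real} s))"
        by simp
    qed measurable
    have "\<bar>indicator {0..1} s * ?D (x - s *\<^sub>R v)\<bar> \<le> \<bar>C * indicator {0..1::real} s\<bar>" for x s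
      using C(1)[of "x - s *\<^sub>R v"] C(2) by (auto simp: indicator_def)
    then show "AE p in lborel \<Otimes>\<^sub>M lborel. norm (?H p) \<le> norm ((\<lambda>(x, s). F x * (C * indicator {0..1::real} s)) p)"
      by (intro AE_I2) (auto simp: abs_mult split: prod.split intro!: mult_left_mono)
  qed measurable
  have "(LINT x|lborel. F x * \<psi> x) - (LINT x|lborel. F x * \<psi> (x - v))
      = (LINT x|lborel. F x * (\<psi> x - \<psi> (x - v)))"
    unfolding right_diff_distrib
    by (rule Bochner_Integration.integral_diff[symmetric])
       (use integrable_test_function[OF F \<psi>, of 0] integrable_test_function[OF F \<psi>, of v] in auto)
  also have "\<dots> = (LINT x|lborel. LINT s|lborel. F x * (indicator {0..1} s * ?D (x - s *\<^sub>R v)))"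
    unfolding test_function_increment[OF \<psi>] Bochner_Integration.integral_mult_right_zero ..
  also have "\<dots> = (LINT s|lborel. LINT x|lborel. F x * (indicator {0..1} s * ?D (x - s *\<^sub>R v)))"
    by (rule lborel_pair.Fubini_integral[OF int, symmetric])
  also have "\<dots> = (LINT s|lborel. indicator {0..1} s * (LINT x|lborel. F x * ?D (x - s *\<^sub>R v)))"
    unfolding mult.left_commute[of "F _"] Bochner_Integration.integral_mult_right_zero ..
  finally show ?thesis .
qed

lemma integral_increment_zero:
  assumes F: "integrable lborel F" and \<psi>: "test_function \<Omega> \<psi>"
    and 0: "\<And>s. 0 \<le> s \<Longrightarrow> s \<le> 1 \<Longrightarrow> (LINT x|lborel. F x * dderiv v \<psi> (x - s *\<^sub>R v)) = 0"
  shows "(LINT x|lborel. F x * \<psi> x) = (LINT x|lborel. F x * \<psi> (x - v))"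
proof -
  have "(LINT s|lborel. indicator {0..1} s * (LINT x|lborel. F x * dderiv v \<psi> (x - s *\<^sub>R v))) = (LINT (s::real)|lborel. (0::real))"
    using 0 by (intro Bochner_Integration.integral_cong) (auto simp: indicator_def)
  then show ?thesis using integral_increment[OF F \<psi>, of v] by simp
qed

text \<open>
  Apply the previous identity with \<open>F\<close> the indicator of a compact set containing all the translates
  of the support.  The left-hand side vanishes by translation invariance, and the inner integral on
  the right is the same for all \<open>s\<close>.
\<close>
lemma integral_dderiv:
  assumes \<psi>: "test_function \<Omega> \<psi>"
  shows "(LINT x|lborel. dderiv v \<psi> x) = 0"
proof -
  from \<psi> obtain K where K': "smooth \<psi>" "compact K" "K \<subseteq> \<Omega>"
      "\<And>x. x \<notin> K \<Longrightarrow> \<psi> x = 0" "\<And>b x. x \<notin> K \<Longrightarrow> dderiv b \<psi> x = 0"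
    using test_function_support by metis
  note K = K'(2) K'(4) K'(5)[of _ v]
  define L where "L = (\<lambda>(x, s). x + s *\<^sub>R v) ` (K \<times> {0..1::real})"
  have "compact L" unfolding L_def
    by (intro compact_continuous_image compact_Times K)
       (auto intro!: continuous_intros simp: case_prod_unfold)
  then have F: "integrable lborel (indicator L :: _ \<Rightarrow> real)"
    by (intro integrable_real_indicator emeasure_compact_finite) (simp add: borel_compact)
  have in_L: "x \<in> L" if "x - s *\<^sub>R v \<in> K" "0 \<le> s" "s \<le> 1" for x s
  proof -
    have "(\<lambda>(x, s). x + s *\<^sub>R v) (x - s *\<^sub>R v, s) \<in> L"
      unfolding L_def by (rule imageI) (use that in simp)
    then show ?thesis by simp
  qed
  have tr: "(LINT x|lborel. indicator L x * f (x - s *\<^sub>R v)) = (LINT x|lborel. f x)"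
    if "f \<in> borel_measurable borel" "\<And>x. x \<notin> K \<Longrightarrow> f x = 0" "0 \<le> s" "s \<le> 1" for f :: "'a \<Rightarrow> real" and s
  proof -
    have "indicator L x * f (x - s *\<^sub>R v) = f (x - s *\<^sub>R v)" for x
      using in_L[of x s] that(2)[of "x - s *\<^sub>R v"] that(3,4) by (cases "x \<in> L") auto
    then have "(LINT x|lborel. indicator L x * f (x - s *\<^sub>R v)) = (LINT x|lborel. f (- (s *\<^sub>R v) + x))"
      by (intro Bochner_Integration.integral_cong) auto
    also have "\<dots> = (LINT x|lborel. f x)"
      by (rule integral_lborel_translate[OF that(1)])
    finally show ?thesis .
  qed
  have 1: "(LINT x|lborel. indicator L x * dderiv v \<psi> (x - s *\<^sub>R v)) = (LINT x|lborel. dderiv v \<psi> x)"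
    if "0 \<le> s" "s \<le> 1" for s
    by (rule tr[OF test_function_measurable[OF test_function_dderiv[OF \<psi>]] K(3) that])
  have 2: "(LINT x|lborel. indicator L x * \<psi> (x - s *\<^sub>R v)) = (LINT x|lborel. \<psi> x)"
    if "0 \<le> s" "s \<le> 1" for s
    by (rule tr[OF test_function_measurable[OF \<psi>] K(2) that])
  have "(LINT s|lborel. indicator {0..1} s * (LINT x|lborel. indicator L x * dderiv v \<psi> (x - s *\<^sub>R v)))
      = (LINT s|lborel. indicator {0..1::real} s * (LINT x|lborel. dderiv v \<psi> x))"
  proof (intro Bochner_Integration.integral_cong refl)
    fix s :: real
    show "indicator {0..1} s * (LINT x|lborel. indicator L x * dderiv v \<psi> (x - s *\<^sub>R v))
        = indicator {0..1} s * (LINT x|lborel. dderiv v \<psi> x)"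
      using 1[of s] by (cases "s \<in> {0..1}") auto
  qed
  also have "\<dots> = (LINT s|lborel. indicator {0..1::real} s) * (LINT x|lborel. dderiv v \<psi> x)"
    by (rule Bochner_Integration.integral_mult_left_zero)
  also have "(LINT s|lborel. indicator {0..1::real} s :: real) = 1"
    unfolding Bochner_Integration.integral_indicator by simp
  finally have "(LINT s|lborel. indicator {0..1} s * (LINT x|lborel. indicator L x * dderiv v \<psi> (x - s *\<^sub>R v)))
      = (LINT x|lborel. dderiv v \<psi> x)"
    by (simp only: mult_1)
  then have "(LINT x|lborel. dderiv v \<psi> x)
      = (LINT x|lborel. indicator L x * \<psi> x) - (LINT x|lborel. indicator L x * \<psi> (x - v))"
    unfolding integral_increment[OF F \<psi>, of v] by (rule sym)
  also have "\<dots> = 0"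
    using 2[of 0] 2[of 1] by (simp only: scaleR_zero_left scaleR_one diff_zero)
  finally show ?thesis .
qed

section \<open>The fundamental lemma of the calculus of variations\<close>

lemma AE_lborel_iff_negligible:
  "(AE x in lborel. P x) \<longleftrightarrow> negligible {x. \<not> P x}"
proof
  assume "AE x in lborel. P x"
  then have "AE x in lebesgue. P x" by (rule AE_completion)
  then obtain N where "{x \<in> space lebesgue. \<not> P x} \<subseteq> N" "N \<in> null_sets lebesgue"
    by (auto simp: eventually_ae_filter)
  then show "negligible {x. \<not> P x}"
    using negligible_subset[of N "{x. \<not> P x}"] by (simp add: negligible_iff_null_sets)
next
  assume "negligible {x. \<not> P x}"
  then have "AE x in lebesgue. x \<notin> {x. \<not> P x}"
    by (intro AE_not_in) (simp add: negligible_iff_null_sets)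
  then show "AE x in lborel. P x" by (simp add: AE_completion_iff)
qed

lemma AE_lborel_translate:
  fixes v :: "'a::euclidean_space"
  assumes "AE x in lborel. P x" shows "AE x in lborel. P (v + x)"
proof -
  have "AE x in distr lborel borel ((+) v). P x"
    using assms by (simp only: lborel_distr_plus)
  then show ?thesis
    by (rule AE_distrD[of "(+) v" lborel borel P, rotated]) simp
qed

text \<open>
  By the Lindelof property countably many of the neighbourhoods cover the exceptional set.
\<close>
lemma AE_lborel_local:
  assumes "\<And>x. x \<in> U \<Longrightarrow> \<exists>V. open V \<and> x \<in> V \<and> (AE y in lborel. y \<in> V \<longrightarrow> P y)"
  shows "AE y in lborel. y \<in> U \<longrightarrow> P y"
proof -
  let ?S = "{y. \<not> (y \<in> U \<longrightarrow> P y)}"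
  have "negligible ?S"
  proof (rule iffD2[OF locally_negligible_alt], rule ballI)
    fix x assume "x \<in> ?S"
    then have "x \<in> U" by simp
    from assms[OF this] obtain V where V: "open V" "x \<in> V" "AE y in lborel. y \<in> V \<longrightarrow> P y"
      by (elim exE conjE)
    have "negligible (?S \<inter> V)"
      by (rule negligible_subset[OF V(3)[unfolded AE_lborel_iff_negligible]]) auto
    moreover have "openin (top_of_set ?S) (?S \<inter> V)" using V(1) by (rule openin_open_Int)
    ultimately show "\<exists>T. openin (top_of_set ?S) T \<and> x \<in> T \<and> negligible T"
      using V(2) \<open>x \<in> ?S\<close> by (intro exI[of _ "?S \<inter> V"]) simp
  qed
  then show ?thesis by (simp only: AE_lborel_iff_negligible)
qed

lemma flat_0_bounds: "0 \<le> flat 0 t" "flat 0 t \<le> 1"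
  by (auto simp: flat_def)

text \<open>
  Smooth approximations of the indicator of a box from below: for \<open>t > 0\<close> the factor \<open>flat 0 (n t)\<close> is
  \<open>exp (- 1 / (n t))\<close>, which increases to 1 as \<open>n\<close> grows.
\<close>
definition bump :: "'a::euclidean_space \<Rightarrow> 'a \<Rightarrow> nat \<Rightarrow> 'a \<Rightarrow> real" where
  "bump a b n x = (\<Prod>i\<in>Basis. flat 0 (real (Suc n) * (x \<bullet> i - a \<bullet> i)) * flat 0 (real (Suc n) * (b \<bullet> i - x \<bullet> i)))"

lemma bump_bounds: "0 \<le> bump a b n x" "bump a b n x \<le> 1"
  unfolding bump_def by (auto intro!: prod_nonneg prod_le_1 mult_nonneg_nonneg mult_le_one flat_0_bounds)

lemma bump_outside: "x \<notin> box a b \<Longrightarrow> bump a b n x = 0"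
  by (force simp: bump_def mem_box flat_def mult_le_0_iff zero_less_mult_iff)

lemma smooth_bump: "smooth (bump a b n)"
proof -
  have lin: "s * (x \<bullet> i - a \<bullet> i) = x \<bullet> (s *\<^sub>R i) + (- s * (a \<bullet> i))"
    "s * (b \<bullet> i - x \<bullet> i) = x \<bullet> (- s *\<^sub>R i) + s * (b \<bullet> i)" for s and x i :: 'a
    by (simp_all add: algebra_simps)
  have "smooth (\<lambda>x. \<Prod>i\<in>Basis. flat 0 (x \<bullet> (real (Suc n) *\<^sub>R i) + (- real (Suc n) * (a \<bullet> i)))
        * flat 0 (x \<bullet> (- real (Suc n) *\<^sub>R i) + real (Suc n) * (b \<bullet> i)))"
    by (rule smooth_prod) (rule smooth_mult; rule smooth_flat)
  moreover have "(\<lambda>x. bump a b n x) = (\<lambda>x. \<Prod>i\<in>Basis. flat 0 (x \<bullet> (real (Suc n) *\<^sub>R i) + (- real (Suc n) * (a \<bullet> i)))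
        * flat 0 (x \<bullet> (- real (Suc n) *\<^sub>R i) + real (Suc n) * (b \<bullet> i)))"
    unfolding bump_def lin by (rule refl)
  ultimately show ?thesis by simp
qed

lemma flat_0_scaled_tendsto:
  assumes "t > 0" shows "(\<lambda>n. flat 0 (real (Suc n) * t)) \<longlonglongrightarrow> 1"
proof -
  have "(\<lambda>n. exp (- (inverse (real (Suc n)) * (1 / t)))) \<longlonglongrightarrow> exp (- (0 * (1 / t)))"
    by (intro tendsto_intros LIMSEQ_inverse_real_of_nat)
  moreover have "flat 0 (real (Suc n) * t) = exp (- (inverse (real (Suc n)) * (1 / t)))" for n
    using assms by (simp add: flat_def divide_inverse)
  ultimately show ?thesis by (simp only: mult_zero_left minus_zero exp_zero)
qed

lemma bump_tendsto: "(\<lambda>n. bump a b n x) \<longlonglongrightarrow> indicator (box a b) x"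
proof (cases "x \<in> box a b")
  case True
  then have "\<forall>i\<in>Basis. 0 < x \<bullet> i - a \<bullet> i \<and> 0 < b \<bullet> i - x \<bullet> i" by (simp add: mem_box)
  then have "(\<lambda>n. bump a b n x) \<longlonglongrightarrow> (\<Prod>i\<in>(Basis::'a set). 1 * 1)"
    unfolding bump_def by (intro tendsto_prod tendsto_mult flat_0_scaled_tendsto) auto
  then show ?thesis using True by simp
qed (simp add: bump_outside)

lemma test_function_bump:
  assumes "cbox a b \<subseteq> U" shows "test_function U (bump a b n)"
  by (rule test_functionI[OF smooth_bump compact_cbox assms])
     (meson bump_outside box_subset_cbox subsetD)

lemma integral_box_zero:
  assumes F: "integrable lborel F" and U: "cbox a b \<subseteq> U"
    and z: "\<And>\<psi>. test_function U \<psi> \<Longrightarrow> (LINT x|lborel. F x * \<psi> x) = 0"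
  shows "(LINT x|lborel. F x * indicator (box a b) x) = 0"
proof -
  have [measurable]: "F \<in> borel_measurable borel" using F by simp
  have [measurable]: "bump a b n \<in> borel_measurable borel" for n
    using test_function_measurable[OF test_function_bump[OF U]] .
  have "(\<lambda>n. LINT x|lborel. F x * bump a b n x) \<longlonglongrightarrow> (LINT x|lborel. F x * indicator (box a b) x)"
  proof (rule integral_dominated_convergence[where w = "\<lambda>x. norm (F x)"])
    show "AE x in lborel. (\<lambda>n. F x * bump a b n x) \<longlonglongrightarrow> F x * indicator (box a b) x"
      by (intro AE_I2 tendsto_mult tendsto_const bump_tendsto)
    show "AE x in lborel. norm (F x * bump a b n x) \<le> norm (F x)" for n
    proof (rule AE_I2)
      fix x
      have "\<bar>F x\<bar> * \<bar>bump a b n x\<bar> \<le> \<bar>F x\<bar> * 1"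
        using bump_bounds[of a b n x] by (intro mult_left_mono) auto
      then show "norm (F x * bump a b n x) \<le> norm (F x)" by (simp add: abs_mult)
    qed
  qed (use F in auto)
  then have "(\<lambda>n::nat. 0) \<longlonglongrightarrow> (LINT x|lborel. F x * indicator (box a b) x)"
    by (simp only: z[OF test_function_bump[OF U]])
  then show ?thesis by (simp only: LIMSEQ_const_iff)
qed

text \<open>
  Testing against bumps shows that \<open>F\<close> integrates to zero over every box inside \<open>U\<close>.  Boxes are closed
  under intersection and generate the Borel sets, so inside a fixed box \<open>F\<close> integrates to zero over
  every Borel set.
\<close>
lemma weakly_zero_imp_AE_zero:
  assumes F: "integrable lborel F" and U: "open U"
    and z: "\<And>\<psi>. test_function U \<psi> \<Longrightarrow> (LINT x|lborel. F x * \<psi> x) = 0"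
  shows "AE x in lborel. x \<in> U \<longrightarrow> F x = 0"
proof (rule AE_lborel_local)
  fix x assume "x \<in> U"
  with U obtain c d where cd: "cbox c d \<subseteq> U" "x \<in> box c d"
    by (rule open_contains_cbox)
  define G where "G = (\<lambda>x. F x * indicator (box c d) x)"
  have G: "integrable lborel G"
    unfolding G_def using F by (intro integrable_real_mult_indicator) auto
  have int: "set_integrable lborel A G" if "A \<in> sets borel" for A
    unfolding set_integrable_def by (rule integrable_mult_indicator) (use that G in auto)
  have basic: "(LINT x:box a b|lborel. G x) = 0" for a b
  proof -
    obtain e f where ef: "box a b \<inter> box c d = box e f"
      using box_Int_box by blast
    have "(LINT x|lborel. F x * indicator (box e f) x) = 0"
    proof (cases "box e f = {}")
      case False
      have "cbox e f = closure (box e f)" using False by simp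
      also have "\<dots> \<subseteq> cbox c d"
        by (rule closure_minimal) (use ef box_subset_cbox[of c d] in auto)
      finally show ?thesis using cd(1) by (intro integral_box_zero[OF F _ z]) auto
    qed simp
    moreover have "indicator (box a b) x *\<^sub>R G x = F x * indicator (box e f) x" for x
      unfolding G_def ef[symmetric] by (auto simp: indicator_def)
    ultimately show ?thesis unfolding set_lebesgue_integral_def by simp
  qed
  have whole: "(LINT x|lborel. G x) = 0"
    using cd(1) unfolding G_def by (rule integral_box_zero[OF F _ z])
  have "(LINT x:A|lborel. G x) = 0" if "A \<in> sets borel" for A
  proof -
    have "A \<in> sigma_sets UNIV (range (\<lambda>(a, b). box a b :: 'a set))"
      using that unfolding borel_eq_box by simp
    moreover have "Int_stable (range (\<lambda>(a, b). box a b :: 'a set))"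
      by (auto simp: Int_stable_def box_Int_box)
    moreover have "range (\<lambda>(a, b). box a b :: 'a set) \<subseteq> Pow UNIV" by simp
    ultimately have "Int_stable (range (\<lambda>(a, b). box a b :: 'a set))" "range (\<lambda>(a, b). box a b :: 'a set) \<subseteq> Pow UNIV"
      "A \<in> sigma_sets UNIV (range (\<lambda>(a, b). box a b :: 'a set))" by blast+
    then show ?thesis
    proof (induct A rule: sigma_sets_induct_disjoint)
      case (basic A)
      then show ?case using \<open>\<And>b a. (LINT x:box a b|lborel. G x) = 0\<close> by auto
    next
      case empty
      show ?case by (simp add: set_lebesgue_integral_def)
    next
      case (compl A)
      then have A: "A \<in> sets borel" by (simp add: borel_eq_box)
      have "(LINT x|lborel. indicator A x *\<^sub>R G x + indicator (UNIV - A) x *\<^sub>R G x)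
          = (LINT x:A|lborel. G x) + (LINT x:(UNIV - A)|lborel. G x)"
        unfolding set_lebesgue_integral_def
        by (rule Bochner_Integration.integral_add)
           (use int[OF A] int[of "UNIV - A"] A in \<open>auto simp: set_integrable_def\<close>)
      moreover have "(\<lambda>x. indicator A x *\<^sub>R G x + indicator (UNIV - A) x *\<^sub>R G x) = G"
        by (auto simp: fun_eq_iff indicator_def)
      ultimately show ?case using whole compl(2) by simp
    next
      case (union A)
      then have A: "A i \<in> sets borel" for i by (auto simp: borel_eq_box)
      have "(LINT x:(\<Union>i. A i)|lborel. G x) = (\<Sum>i. (LINT x:(A i)|lborel. G x))"
        using A union(1) int[of "\<Union>i. A i"]
        by (intro lebesgue_integral_countable_add) (auto simp: disjoint_family_on_def)
      then show ?case using union(3) by simp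
    qed
  qed
  then have "AE y in lborel. G y = 0"
    by (intro density_unique_real G) (auto simp: set_lebesgue_integral_def)
  then have "AE y in lborel. y \<in> box c d \<longrightarrow> F y = 0"
    by eventually_elim (auto simp: G_def indicator_def split: if_splits)
  then show "\<exists>V. open V \<and> x \<in> V \<and> (AE y in lborel. y \<in> V \<longrightarrow> F y = 0)"
    using cd(2) open_box by blast
qed

section \<open>Second differences\<close>

text \<open>
  The distributional equation \<open>\<partial>\<^sub>v \<partial>\<^sub>w F = 0\<close> as an identity between values.  It is enough to
  test the identity; moved onto the test function \<open>\<psi>\<close>, it says that the second difference of \<open>\<psi>\<close>
  integrates to zero against \<open>F\<close>.  That difference is an integral of the mixed derivatives of the
  translates of \<open>\<psi>\<close> by \<open>s v + t w\<close> with \<open>s\<close> and \<open>t\<close> in \<open>[0, 1]\<close>.  Convexity of \<open>U\<close> keeps the supports of all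
  these translates inside \<open>U\<close>.
\<close>
lemma second_difference:
  fixes F :: "'a::euclidean_space \<Rightarrow> real"
  assumes F: "integrable lborel F" and U: "open U" "convex U"
    and z: "\<And>\<phi>. test_function U \<phi> \<Longrightarrow> (LINT x|lborel. F x * dderiv v (dderiv w \<phi>) x) = 0"
  shows "AE x in lborel. x \<in> U \<and> x + v \<in> U \<and> x + w \<in> U \<and> x + v + w \<in> U
    \<longrightarrow> F x + F (x + v + w) = F (x + v) + F (x + w)"
proof -
  define V where "V = {x. x \<in> U \<and> x + v \<in> U \<and> x + w \<in> U \<and> x + v + w \<in> U}"
  define G where "G = (\<lambda>x. F x - F (v + x) - F (w + x) + F ((v + w) + x))"
  have shift: "integrable lborel (\<lambda>x. F (c + x))" for c
  proof -
    have "integrable (distr lborel borel ((+) c)) F" using F by (simp add: lborel_distr_plus)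
    then show ?thesis by (rule integrable_distr[rotated]) simp
  qed
  have V: "V = U \<inter> (\<lambda>x. x + v) -` U \<inter> (\<lambda>x. x + w) -` U \<inter> (\<lambda>x. x + v + w) -` U"
    by (auto simp: V_def)
  have oV: "open V"
    unfolding V by (intro open_Int open_vimage U continuous_intros)
  have "AE x in lborel. x \<in> V \<longrightarrow> G x = 0"
  proof (rule weakly_zero_imp_AE_zero[OF _ oV])
    show "integrable lborel G"
      unfolding G_def by (intro Bochner_Integration.integrable_add Bochner_Integration.integrable_diff F shift)
    fix \<psi> assume \<psi>: "test_function V \<psi>"
    then have sm: "smooth \<psi>" by (rule test_function_smooth)
    from \<psi> obtain K where K: "smooth \<psi>" "compact K" "K \<subseteq> V"
      "\<And>x. x \<notin> K \<Longrightarrow> \<psi> x = 0" "\<And>b x. x \<notin> K \<Longrightarrow> dderiv b \<psi> x = 0"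
      using test_function_support by metis
    have test: "test_function U (\<lambda>x. \<psi> (x - (s *\<^sub>R v + t *\<^sub>R w)))"
      if "0 \<le> s" "s \<le> 1" "0 \<le> t" "t \<le> 1" for s t
    proof (rule test_function_mono[OF test_function_translate])
      show "test_function K \<psi>" by (rule test_functionI[OF K(1,2) order_refl K(4)])
      have "y + s *\<^sub>R v + t *\<^sub>R w \<in> U" if "y \<in> K" for y
      proof -
        have y: "y \<in> U" "y + v \<in> U" "y + w \<in> U" "y + v + w \<in> U" using that K(3) by (auto simp: V_def)
        have "(1 - s) *\<^sub>R y + s *\<^sub>R (y + v) \<in> U" "(1 - s) *\<^sub>R (y + w) + s *\<^sub>R (y + v + w) \<in> U"
          by (rule convexD[OF U(2)]; use \<open>0 \<le> s\<close> \<open>s \<le> 1\<close> y in simp)+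
        then have "(1 - t) *\<^sub>R ((1 - s) *\<^sub>R y + s *\<^sub>R (y + v)) + t *\<^sub>R ((1 - s) *\<^sub>R (y + w) + s *\<^sub>R (y + v + w)) \<in> U"
          using \<open>0 \<le> t\<close> \<open>t \<le> 1\<close> by (rule_tac convexD[OF U(2)]) simp_all
        also have "(1 - t) *\<^sub>R ((1 - s) *\<^sub>R y + s *\<^sub>R (y + v)) + t *\<^sub>R ((1 - s) *\<^sub>R (y + w) + s *\<^sub>R (y + v + w))
            = y + s *\<^sub>R v + t *\<^sub>R w"
          by (simp add: algebra_simps)
        finally show ?thesis .
      qed
      then show "(+) (s *\<^sub>R v + t *\<^sub>R w) ` K \<subseteq> U"
        by (auto simp: algebra_simps)
    qed
    \<comment> \<open>First in direction \<open>v\<close>, for every translate of \<open>\<psi>\<close> along \<open>w\<close>; the direction \<open>w\<close> is integrated afterwards.\<close>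
    have mixed: "(LINT x|lborel. F x * dderiv w \<psi> (x - t *\<^sub>R w)) = (LINT x|lborel. F x * dderiv w \<psi> (x - v - t *\<^sub>R w))"
      if t: "0 \<le> t" "t \<le> 1" for t
    proof -
      let ?\<phi> = "\<lambda>x. dderiv w \<psi> (x - t *\<^sub>R w)"
      note smw = smooth_dderiv[OF sm, of w]
      have "(LINT x|lborel. F x * ?\<phi> x) = (LINT x|lborel. F x * ?\<phi> (x - v))"
      proof (rule integral_increment_zero[OF F])
        show "test_function UNIV ?\<phi>"
          by (rule test_function_mono[OF test_function_translate[OF test_function_dderiv[OF \<psi>]]]) simp
        fix s :: real assume s: "0 \<le> s" "s \<le> 1"
        have "dderiv v (dderiv w (\<lambda>x. \<psi> (x - (s *\<^sub>R v + t *\<^sub>R w)))) x = dderiv v (dderiv w \<psi>) (x - (s *\<^sub>R v + t *\<^sub>R w))" for x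
          unfolding dderiv_translate(2)[OF sm] by (rule fun_cong[OF dderiv_translate(2)[OF smw]])
        then have "(LINT x|lborel. F x * dderiv v (dderiv w \<psi>) (x - (s *\<^sub>R v + t *\<^sub>R w))) = 0"
          using z[OF test[OF s t]] by (simp only:)
        moreover have "dderiv v ?\<phi> (x - s *\<^sub>R v) = dderiv v (dderiv w \<psi>) (x - (s *\<^sub>R v + t *\<^sub>R w))" for x
          using fun_cong[OF dderiv_translate(2)[OF smw]] by (simp only: diff_diff_add)
        ultimately show "(LINT x|lborel. F x * dderiv v ?\<phi> (x - s *\<^sub>R v)) = 0"
          by (simp only:)
      qed
      then show ?thesis .
    qed
    note \<psi>v = test_function_translate[OF \<psi>, of v]
    have "(LINT x|lborel. F x * \<psi> x) - (LINT x|lborel. F x * \<psi> (x - w))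
        = (LINT s|lborel. indicator {0..1} s * (LINT x|lborel. F x * dderiv w \<psi> (x - s *\<^sub>R w)))"
      by (rule integral_increment[OF F \<psi>])
    also have "\<dots> = (LINT s|lborel. indicator {0..1} s * (LINT x|lborel. F x * dderiv w \<psi> (x - v - s *\<^sub>R w)))"
    proof (intro Bochner_Integration.integral_cong refl)
      fix s :: real
      show "indicator {0..1} s * (LINT x|lborel. F x * dderiv w \<psi> (x - s *\<^sub>R w))
        = indicator {0..1} s * (LINT x|lborel. F x * dderiv w \<psi> (x - v - s *\<^sub>R w))"
        using mixed[of s] by (cases "s \<in> {0..1}") (simp_all only: atLeastAtMost_iff indicator_simps simp_thms mult_zero_left)
    qed
    also have "\<dots> = (LINT s|lborel. indicator {0..1} s * (LINT x|lborel. F x * dderiv w (\<lambda>x. \<psi> (x - v)) (x - s *\<^sub>R w)))"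
      by (simp only: fun_cong[OF dderiv_translate(2)[OF sm]] diff_diff_add add.commute[of v])
    also have "\<dots> = (LINT x|lborel. F x * \<psi> (x - v)) - (LINT x|lborel. F x * \<psi> (x - w - v))"
      by (rule integral_increment[OF F \<psi>v, symmetric])
    finally have eq: "(LINT x|lborel. F x * \<psi> x) - (LINT x|lborel. F x * \<psi> (x - w))
      = (LINT x|lborel. F x * \<psi> (x - v)) - (LINT x|lborel. F x * \<psi> (x - w - v))" .
    have [measurable]: "\<psi> \<in> borel_measurable borel" "F \<in> borel_measurable borel"
      using test_function_measurable[OF \<psi>] F by auto
    have move: "(LINT x|lborel. F (c + x) * \<psi> x) = (LINT x|lborel. F x * \<psi> (x - c))" for c
      using integral_lborel_translate[of "\<lambda>x. F x * \<psi> (x - c)" c]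
      unfolding add_diff_cancel_left' by measurable
    have im: "integrable lborel (\<lambda>x. F (c + x) * \<psi> x)" for c
      using integrable_test_function[OF shift[of c] \<psi>, of 0] by simp
    have i0: "integrable lborel (\<lambda>x. F x * \<psi> x)"
      using im[of 0] by simp
    have "(LINT x|lborel. G x * \<psi> x) = (LINT x|lborel. F x * \<psi> x - F (v + x) * \<psi> x - F (w + x) * \<psi> x + F ((v + w) + x) * \<psi> x)"
      unfolding G_def by (simp only: ring_distribs)
    also have "\<dots> = (LINT x|lborel. F x * \<psi> x) - (LINT x|lborel. F (v + x) * \<psi> x)
        - (LINT x|lborel. F (w + x) * \<psi> x) + (LINT x|lborel. F ((v + w) + x) * \<psi> x)"
      by (simp only: Bochner_Integration.integral_add Bochner_Integration.integral_diff
          Bochner_Integration.integrable_add Bochner_Integration.integrable_diff i0 im)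
    also have "\<dots> = 0"
      using eq unfolding move diff_diff_add add.commute[of w v] by linarith
    finally show "(LINT x|lborel. G x * \<psi> x) = 0" .
  qed
  then show ?thesis
  proof eventually_elim
    case (elim x)
    have "G x = F x - F (x + v) - F (x + w) + F (x + v + w)"
      unfolding G_def by (simp only: add.commute[of _ x] add.assoc)
    then show ?case using elim unfolding V_def mem_Collect_eq by linarith
  qed
qed

lemma dderiv_linear_direction:
  assumes "smooth f"
  shows "dderiv (s *\<^sub>R v + t *\<^sub>R w) f x = s * dderiv v f x + t * dderiv w f x"
proof -
  have "linear (frechet_derivative f (at x))"
    using smooth_has_derivative[OF assms, of x]
    by (simp add: bounded_linear.linear has_derivative_bounded_linear)
  then show ?thesis by (simp add: linear_add linear_cmul)
qed

lemma dderiv_linear_function: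
  assumes "smooth f" "smooth g"
  shows "dderiv v (\<lambda>x. s * f x + t * g x) x = s * dderiv v f x + t * dderiv v g x"
  by (rule dderiv_eqI)
     (intro has_derivative_add has_derivative_mult_right smooth_has_derivative assms)

lemma second_difference_scaled:
  fixes F :: "'a::euclidean_space \<Rightarrow> real"
  assumes F: "integrable lborel F" and U: "open U" "convex U"
    and z: "\<And>\<phi>. test_function U \<phi> \<Longrightarrow> (LINT x|lborel. F x * dderiv v (dderiv w \<phi>) x) = 0"
  shows "AE x in lborel. x \<in> U \<and> x + s *\<^sub>R v \<in> U \<and> x + t *\<^sub>R w \<in> U \<and> x + s *\<^sub>R v + t *\<^sub>R w \<in> U
    \<longrightarrow> F x + F (x + s *\<^sub>R v + t *\<^sub>R w) = F (x + s *\<^sub>R v) + F (x + t *\<^sub>R w)"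
proof (rule second_difference[OF F U])
  fix \<phi> assume \<phi>: "test_function U \<phi>"
  then have sm: "smooth \<phi>" by (rule test_function_smooth)
  have 1: "dderiv (r *\<^sub>R u) f y = r * dderiv u f y" if "smooth f" for r :: real and u y :: 'a and f :: "'a \<Rightarrow> real"
    using dderiv_linear_direction[OF that, where s = r and v = u and t = 0 and w = 0 and x = y] by simp
  have 2: "dderiv u (\<lambda>x. r * f x) y = r * dderiv u f y" if "smooth f" for r :: real and u y :: 'a and f :: "'a \<Rightarrow> real"
    using dderiv_linear_function[OF that that, where v = u and s = r and t = 0 and x = y] by simp
  have "dderiv (s *\<^sub>R v) (dderiv (t *\<^sub>R w) \<phi>) x = (s * t) * dderiv v (dderiv w \<phi>) x" for x
  proof -
    have "dderiv (t *\<^sub>R w) \<phi> = (\<lambda>x. t * dderiv w \<phi> x)"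
      by (rule ext) (rule 1[OF sm])
    then have "dderiv v (dderiv (t *\<^sub>R w) \<phi>) x = t * dderiv v (dderiv w \<phi>) x"
      using 2[OF smooth_dderiv[OF sm]] by (simp only:)
    moreover have "dderiv (s *\<^sub>R v) (dderiv (t *\<^sub>R w) \<phi>) x = s * dderiv v (dderiv (t *\<^sub>R w) \<phi>) x"
      by (rule 1[OF smooth_dderiv[OF sm]])
    ultimately show ?thesis by (simp only: mult.assoc)
  qed
  then have "(LINT x|lborel. F x * dderiv (s *\<^sub>R v) (dderiv (t *\<^sub>R w) \<phi>) x)
      = (LINT x|lborel. (s * t) * (F x * dderiv v (dderiv w \<phi>) x))"
    by (simp only: mult.left_commute)
  also have "\<dots> = (s * t) * (LINT x|lborel. F x * dderiv v (dderiv w \<phi>) x)"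
    by (rule Bochner_Integration.integral_mult_right_zero)
  also have "\<dots> = 0" using z[OF \<phi>] by (simp only: mult_zero_right)
  finally show "(LINT x|lborel. F x * dderiv (s *\<^sub>R v) (dderiv (t *\<^sub>R w) \<phi>) x) = 0" .
qed

section \<open>Functions that are constant almost everywhere\<close>

text \<open>
  By Fubini some \<open>x\<close> in \<open>U\<close> satisfies \<open>F (v + x) = F x\<close> for almost every \<open>v\<close>.
\<close>
lemma translation_invariant_imp_const:
  fixes F :: "'a::euclidean_space \<Rightarrow> real"
  assumes [measurable]: "F \<in> borel_measurable borel" and U: "open U" "U \<noteq> {}"
    and inv: "\<And>v. AE x in lborel. x \<in> U \<and> v + x \<in> U \<longrightarrow> F (v + x) = F x"
  shows "\<exists>c. AE x in lborel. x \<in> U \<longrightarrow> F x = c"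
proof -
  have [measurable]: "U \<in> sets borel" using U by simp
  have "AE v in lborel. AE x in lborel. x \<in> U \<and> v + x \<in> U \<longrightarrow> F (v + x) = F x"
    using inv by (rule AE_I2)
  then have "AE x in lborel. AE v in lborel. x \<in> U \<and> v + x \<in> U \<longrightarrow> F (v + x) = F x"
    by (subst (asm) lborel_pair.AE_commute) measurable
  then have "negligible {x. \<not> (AE v in lborel. x \<in> U \<and> v + x \<in> U \<longrightarrow> F (v + x) = F x)}"
    by (simp only: AE_lborel_iff_negligible)
  moreover have "\<not> negligible U"
    using U open_not_negligible by blast
  ultimately obtain x where x: "x \<in> U" "AE v in lborel. x \<in> U \<and> v + x \<in> U \<longrightarrow> F (v + x) = F x"
    using negligible_subset by blast
  from AE_lborel_translate[OF x(2), of "- x"]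
  have "AE y in lborel. y \<in> U \<longrightarrow> F y = F x"
    using x(1) by simp
  then show ?thesis ..
qed

text \<open>
  Overlapping balls carry the same constant, because their intersection is open and so not a null set.
  The local constant is therefore locally constant on the connected set.
\<close>
lemma locally_AE_const_imp_const:
  fixes f :: "'a::euclidean_space \<Rightarrow> real"
  assumes \<Omega>: "connected \<Omega>"
    and loc: "\<And>x. x \<in> \<Omega> \<Longrightarrow> \<exists>r>0. \<exists>c. AE y in lborel. y \<in> ball x r \<longrightarrow> f y = c"
  shows "\<exists>c. AE y in lborel. y \<in> \<Omega> \<longrightarrow> f y = c"
proof -
  obtain r c where r: "\<And>x. x \<in> \<Omega> \<Longrightarrow> 0 < r x"
    and c: "\<And>x. x \<in> \<Omega> \<Longrightarrow> AE y in lborel. y \<in> ball x (r x) \<longrightarrow> f y = c x"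
    using loc by metis
  have "c constant_on \<Omega>"
  proof (rule locally_constant_imp_constant[OF \<Omega>])
    fix a assume a: "a \<in> \<Omega>"
    have "c x = c a" if x: "x \<in> \<Omega> \<inter> ball a (r a)" for x
    proof (rule ccontr)
      assume "c x \<noteq> c a"
      have "AE y in lborel. \<not> y \<in> ball a (r a) \<inter> ball x (r x)"
        using c[OF a] c[OF IntD1[OF x]] by eventually_elim (use \<open>c x \<noteq> c a\<close> in auto)
      then have "negligible (ball a (r a) \<inter> ball x (r x))"
        by (simp only: AE_lborel_iff_negligible not_not Collect_mem_eq)
      then have "ball a (r a) \<inter> ball x (r x) = {}"
        using open_not_negligible by (metis open_Int open_ball)
      then show False using x r[of x] by auto
    qed
    then have "\<forall>x \<in> \<Omega> \<inter> ball a (r a). c x = c a" by (rule ballI)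
    moreover have "openin (top_of_set \<Omega>) (\<Omega> \<inter> ball a (r a))" by (rule openin_open_Int[OF open_ball])
    moreover have "a \<in> \<Omega> \<inter> ball a (r a)" using a r[OF a] by simp
    ultimately show "\<exists>T. openin (top_of_set \<Omega>) T \<and> a \<in> T \<and> (\<forall>x\<in>T. c x = c a)"
      by (intro exI[of _ "\<Omega> \<inter> ball a (r a)"] conjI)
  qed
  then have "\<exists>k. \<forall>x\<in>\<Omega>. c x = k" unfolding constant_on_def .
  then obtain k where k: "\<forall>x\<in>\<Omega>. c x = k" ..
  have "AE y in lborel. y \<in> \<Omega> \<longrightarrow> f y = k"
  proof (rule AE_lborel_local)
    fix x assume x: "x \<in> \<Omega>"
    show "\<exists>V. open V \<and> x \<in> V \<and> (AE y in lborel. y \<in> V \<longrightarrow> f y = k)"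
      using c[OF x] bspec[OF k x] r[OF x] by (intro exI[of _ "ball x (r x)"]) simp
  qed
  then show ?thesis ..
qed

text \<open>
  A shift by \<open>v\<close> is a composition of three shifts along the axes.  The radius shrinks by the factor 8
  so that the two intermediate points stay in the ball where these shifts are controlled: \<open>v\<close> has
  norm at most \<open>r / 4\<close>, and \<open>r / 8 + r / 4 + r / 4 < r\<close>.
\<close>
lemma axis_shift_invariant_imp_const:
  fixes A :: "real^3 \<Rightarrow> real"
  assumes A: "A \<in> borel_measurable borel" and r: "0 < r"
    and inv: "\<And>h m. \<bar>h\<bar> \<le> r \<Longrightarrow> AE x in lborel. x \<in> ball x0 r \<longrightarrow> A (h *\<^sub>R axis m 1 + x) = A x"
  shows "\<exists>c. AE x in lborel. x \<in> ball x0 (r / 8) \<longrightarrow> A x = c"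
proof (rule translation_invariant_imp_const[OF A open_ball])
  show "ball x0 (r / 8) \<noteq> {}" using r by simp
  fix v :: "real^3"
  let ?B = "ball x0 (r / 8)"
  show "AE x in lborel. x \<in> ?B \<and> v + x \<in> ?B \<longrightarrow> A (v + x) = A x"
  proof (cases "norm v \<le> r / 4")
    case False
    have "\<not> (x \<in> ?B \<and> v + x \<in> ?B)" for x
    proof
      assume x: "x \<in> ?B \<and> v + x \<in> ?B"
      have "norm v \<le> dist x0 x + dist x0 (v + x)"
        using dist_triangle2[of x "v + x" x0] by (simp add: dist_norm norm_minus_commute)
      then show False using x False by simp
    qed
    then show ?thesis by (intro AE_I2) blast
  next
    case True
    have v: "\<bar>v $ m\<bar> \<le> r / 4" for m
      using component_le_norm_cart[of v m] True by linarith
    have h: "\<bar>v $ m\<bar> \<le> r" for m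
      using r v[of m] by linarith
    define p q where "p = (v $ 1) *\<^sub>R (axis 1 1 :: real^3)" and "q = (v $ 2) *\<^sub>R (axis 2 1 :: real^3)"
    have nv: "norm p \<le> r / 4" "norm q \<le> r / 4"
      using v by (simp_all add: p_def q_def norm_axis_1)
    have "v = (\<Sum>m\<in>UNIV. (v $ m) *\<^sub>R axis m 1)"
      by (metis (no_types, lifting) basis_expansion scalar_mult_eq_scaleR sum.cong)
    then have sum: "v + x = (v $ 3) *\<^sub>R axis 3 1 + (q + (p + x))" for x
      by (simp add: sum_3 p_def q_def algebra_simps)
    have 2: "AE x in lborel. p + x \<in> ball x0 r \<longrightarrow> A (q + (p + x)) = A (p + x)"
      unfolding q_def by (rule AE_lborel_translate[OF inv[OF h]])
    have "AE x in lborel. (q + p) + x \<in> ball x0 r \<longrightarrow> A ((v $ 3) *\<^sub>R axis 3 1 + ((q + p) + x)) = A ((q + p) + x)"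
      by (rule AE_lborel_translate[OF inv[OF h]])
    then have 3: "AE x in lborel. q + (p + x) \<in> ball x0 r \<longrightarrow> A (v + x) = A (q + (p + x))"
      unfolding sum by (simp only: add.assoc)
    show ?thesis
      using inv[OF h, of 1 1, folded p_def] 2 3
    proof eventually_elim
      case (elim x)
      show ?case
      proof
        assume "x \<in> ?B \<and> v + x \<in> ?B"
        then have x: "dist x0 x < r / 8" by simp
        have p: "dist x0 (p + x) \<le> dist x0 x + r / 4"
          using dist_triangle[of x0 "p + x" x] nv(1) by (simp add: dist_norm norm_minus_commute)
        have q: "dist x0 (q + (p + x)) \<le> dist x0 (p + x) + r / 4"
          using dist_triangle[of x0 "q + (p + x)" "p + x"] nv(2) by (simp add: dist_norm norm_minus_commute)
        have "x \<in> ball x0 r" "p + x \<in> ball x0 r" "q + (p + x) \<in> ball x0 r"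
          using x p q r by simp_all
        then show "A (v + x) = A x" using elim by simp
      qed
    qed
  qed
qed

section \<open>Rigidity on a finite grid\<close>

text \<open>
  The three numbers contain no arithmetic progression, so a sum of two of them (possibly equal)
  determines the two summands.
\<close>
lemma sidon_triple:
  fixes \<eta>1 \<eta>2 \<eta>3 :: real
  assumes "\<eta>2 < \<eta>1" "\<eta>1 < \<eta>3" "\<eta>2 + \<eta>3 \<noteq> 2 * \<eta>1"
    and "{p, q, r, s} \<subseteq> {\<eta>1, \<eta>2, \<eta>3}" "p + s = q + r"
  shows "(p = q \<and> r = s) \<or> (p = r \<and> q = s)"
  using assms by auto

text \<open>
  The hypothesis is what the parallelogram identity becomes for values in a Sidon set: each rectangle
  is constant along one of its two directions.  If the values vary with \<open>i\<close> in one row, then both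
  entries of that row stay the same in all other rows, which leaves no room for a variation with
  \<open>j\<close> anywhere.
\<close>
lemma depends_on_one_of_two:
  assumes swap: "\<And>i i' j j'. \<lbrakk>i \<in> I; i' \<in> I; j \<in> J; j' \<in> J\<rbrakk> \<Longrightarrow>
      (f i j = f i' j \<and> f i j' = f i' j') \<or> (f i j = f i j' \<and> f i' j = f i' j')"
  shows "(\<forall>i\<in>I. \<forall>i'\<in>I. \<forall>j\<in>J. f i j = f i' j) \<or> (\<forall>i\<in>I. \<forall>j\<in>J. \<forall>j'\<in>J. f i j = f i j')"
proof (rule ccontr)
  assume "\<not> ?thesis"
  then obtain i0 i0' j0 i1 j1 j1' where
    0: "i0 \<in> I" "i0' \<in> I" "j0 \<in> J" "f i0 j0 \<noteq> f i0' j0" and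
    1: "i1 \<in> I" "j1 \<in> J" "j1' \<in> J" "f i1 j1 \<noteq> f i1 j1'"
    by blast
  have "f i0 j1 = f i0 j0" "f i0 j1' = f i0 j0"
    using swap[OF 0(1,2,3) 1(2)] swap[OF 0(1,2,3) 1(3)] 0(4) by simp_all
  then show False
    using swap[OF 0(1) 1(1,2,3)] 1(4) by metis
qed

text \<open>
  On each coordinate plane \<open>f\<close> depends on one coordinate only.  If \<open>f i\<close> is, say, a non-constant function of
  \<open>k\<close>, then the planes with \<open>j\<close> fixed meet it in a line along which \<open>f\<close> varies with \<open>k\<close>; so in
  those planes \<open>f\<close> depends on \<open>k\<close> only, and these planes fill the whole grid.
\<close>
lemma depends_on_one_of_three:
  assumes s12: "\<And>i i' j j' k. \<lbrakk>i \<in> I; i' \<in> I; j \<in> J; j' \<in> J; k \<in> K\<rbrakk> \<Longrightarrow>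
      (f i j k = f i' j k \<and> f i j' k = f i' j' k) \<or> (f i j k = f i j' k \<and> f i' j k = f i' j' k)"
    and s13: "\<And>i i' j k k'. \<lbrakk>i \<in> I; i' \<in> I; j \<in> J; k \<in> K; k' \<in> K\<rbrakk> \<Longrightarrow>
      (f i j k = f i' j k \<and> f i j k' = f i' j k') \<or> (f i j k = f i j k' \<and> f i' j k = f i' j k')"
    and s23: "\<And>i j j' k k'. \<lbrakk>i \<in> I; j \<in> J; j' \<in> J; k \<in> K; k' \<in> K\<rbrakk> \<Longrightarrow>
      (f i j k = f i j' k \<and> f i j k' = f i j' k') \<or> (f i j k = f i j k' \<and> f i j' k = f i j' k')"
  shows "(\<forall>i\<in>I. \<forall>j\<in>J. \<forall>j'\<in>J. \<forall>k\<in>K. \<forall>k'\<in>K. f i j k = f i j' k')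
    \<or> (\<forall>i\<in>I. \<forall>i'\<in>I. \<forall>j\<in>J. \<forall>k\<in>K. \<forall>k'\<in>K. f i j k = f i' j k')
    \<or> (\<forall>i\<in>I. \<forall>i'\<in>I. \<forall>j\<in>J. \<forall>j'\<in>J. \<forall>k\<in>K. f i j k = f i' j' k)"
proof (rule disjCI)
  assume "\<not> ((\<forall>i\<in>I. \<forall>i'\<in>I. \<forall>j\<in>J. \<forall>k\<in>K. \<forall>k'\<in>K. f i j k = f i' j k')
    \<or> (\<forall>i\<in>I. \<forall>i'\<in>I. \<forall>j\<in>J. \<forall>j'\<in>J. \<forall>k\<in>K. f i j k = f i' j' k))"
  then have not2: "\<not> (\<forall>i\<in>I. \<forall>i'\<in>I. \<forall>j\<in>J. \<forall>k\<in>K. \<forall>k'\<in>K. f i j k = f i' j k')"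
    and not3: "\<not> (\<forall>i\<in>I. \<forall>i'\<in>I. \<forall>j\<in>J. \<forall>j'\<in>J. \<forall>k\<in>K. f i j k = f i' j' k)"
    by simp_all
  have d12: "(\<forall>i\<in>I. \<forall>i'\<in>I. \<forall>j\<in>J. f i j k = f i' j k) \<or> (\<forall>i\<in>I. \<forall>j\<in>J. \<forall>j'\<in>J. f i j k = f i j' k)"
    if "k \<in> K" for k
    by (rule depends_on_one_of_two) (rule s12; (assumption | rule that))
  have d13: "(\<forall>i\<in>I. \<forall>i'\<in>I. \<forall>k\<in>K. f i j k = f i' j k) \<or> (\<forall>i\<in>I. \<forall>k\<in>K. \<forall>k'\<in>K. f i j k = f i j k')"
    if "j \<in> J" for j
    by (rule depends_on_one_of_two) (rule s13; (assumption | rule that))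
  have d23: "(\<forall>j\<in>J. \<forall>j'\<in>J. \<forall>k\<in>K. f i j k = f i j' k) \<or> (\<forall>j\<in>J. \<forall>k\<in>K. \<forall>k'\<in>K. f i j k = f i j k')"
    if "i \<in> I" for i
    by (rule depends_on_one_of_two) (rule s23; (assumption | rule that))
  show "\<forall>i\<in>I. \<forall>j\<in>J. \<forall>j'\<in>J. \<forall>k\<in>K. \<forall>k'\<in>K. f i j k = f i j' k'"
  proof (intro ballI, rule ccontr)
    fix i j j' k k' assume *: "i \<in> I" "j \<in> J" "j' \<in> J" "k \<in> K" "k' \<in> K" "f i j k \<noteq> f i j' k'"
    from d23[OF *(1)] show False
    proof
      assume k: "\<forall>j\<in>J. \<forall>j'\<in>J. \<forall>k\<in>K. f i j k = f i j' k"
      then have ne: "f i j1 k \<noteq> f i j1 k'" if "j1 \<in> J" for j1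
        using * that by metis
      have "f i1 j1 k1 = f i j1 k1" if "i1 \<in> I" "j1 \<in> J" "k1 \<in> K" for i1 j1 k1
        using d13[OF that(2)] ne[OF that(2)] that * by metis
      then have "\<forall>i1\<in>I. \<forall>i'\<in>I. \<forall>j\<in>J. \<forall>j'\<in>J. \<forall>k\<in>K. f i1 j k = f i' j' k"
        using k by metis
      with not3 show False by contradiction
    next
      assume j: "\<forall>j\<in>J. \<forall>k\<in>K. \<forall>k'\<in>K. f i j k = f i j k'"
      then have ne: "f i j k1 \<noteq> f i j' k1" if "k1 \<in> K" for k1
        using * that by metis
      have "f i1 j1 k1 = f i j1 k1" if "i1 \<in> I" "j1 \<in> J" "k1 \<in> K" for i1 j1 k1
        using d12[OF that(3)] ne[OF that(3)] that * by metis
      then have "\<forall>i1\<in>I. \<forall>i'\<in>I. \<forall>j\<in>J. \<forall>k\<in>K. \<forall>k'\<in>K. f i1 j k = f i' j k'"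
        using j by metis
      with not2 show False by contradiction
    qed
  qed
qed

text \<open>
  The wells are cyclic permutations of three distinct numbers, so each of the three entries identifies
  the well.
\<close>
lemma wells_determined:
  fixes \<eta>1 \<eta>2 \<eta>3 :: real
  assumes "\<eta>2 < \<eta>1" "\<eta>1 < \<eta>3"
    and "(p, q, r) \<in> {(\<eta>3, \<eta>1, \<eta>2), (\<eta>2, \<eta>3, \<eta>1), (\<eta>1, \<eta>2, \<eta>3)}"
    and "(p', q', r') \<in> {(\<eta>3, \<eta>1, \<eta>2), (\<eta>2, \<eta>3, \<eta>1), (\<eta>1, \<eta>2, \<eta>3)}"
  shows "q = q' \<longleftrightarrow> p = p'" "r = r' \<longleftrightarrow> p = p'"
  using assms by auto

text \<open>
  The identities in the coordinate planes leave a function of one coordinate.  The diagonals of the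
  parallelogram in the fourth identity are \<open>{x, x + v + w}\<close> and \<open>{x + v, x + w}\<close> for \<open>v = (1, 1, 1)\<close> and
  \<open>w = (1, -1, -1)\<close>, and they carry the same pair of values.  Along the first axis they project to
  \<open>{0, 2}\<close> and \<open>{1}\<close>, along the other two to \<open>{0}\<close> and \<open>{1, -1}\<close>, so a function of one coordinate takes
  one value on three consecutive grid positions.
\<close>
lemma grid_rigidity:
  fixes a b c :: "int \<Rightarrow> int \<Rightarrow> int \<Rightarrow> real"
  defines "I \<equiv> {0, 1, 2}" and "J \<equiv> {-1, 0, 1}"
  assumes \<eta>: "\<eta>2 < \<eta>1" "\<eta>1 < \<eta>3" "\<eta>2 + \<eta>3 \<noteq> 2 * \<eta>1"
    and wells: "\<And>i j k. \<lbrakk>i \<in> I; j \<in> J; k \<in> J\<rbrakk> \<Longrightarrow>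
      (a i j k, b i j k, c i j k) \<in> {(\<eta>3, \<eta>1, \<eta>2), (\<eta>2, \<eta>3, \<eta>1), (\<eta>1, \<eta>2, \<eta>3)}"
    and d23: "\<And>i j j' k k'. \<lbrakk>i \<in> I; j \<in> J; j' \<in> J; k \<in> J; k' \<in> J\<rbrakk> \<Longrightarrow>
      a i j k + a i j' k' = a i j' k + a i j k'"
    and d13: "\<And>i i' j k k'. \<lbrakk>i \<in> I; i' \<in> I; j \<in> J; k \<in> J; k' \<in> J\<rbrakk> \<Longrightarrow>
      b i j k + b i' j k' = b i' j k + b i j k'"
    and d12: "\<And>i i' j j' k. \<lbrakk>i \<in> I; i' \<in> I; j \<in> J; j' \<in> J; k \<in> J\<rbrakk> \<Longrightarrow>
      c i j k + c i' j' k = c i' j k + c i j' k"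
    and diag: "a 0 0 0 + a 2 0 0 = a 1 1 1 + a 1 (- 1) (- 1)"
  shows "a 1 0 0 = a 0 0 0" "a 0 1 0 = a 0 0 0" "a 0 0 1 = a 0 0 0"
proof -
  note sidon = sidon_triple[OF \<eta>]
  have mem: "a i j k \<in> {\<eta>1, \<eta>2, \<eta>3}" "b i j k \<in> {\<eta>1, \<eta>2, \<eta>3}" "c i j k \<in> {\<eta>1, \<eta>2, \<eta>3}"
    if "i \<in> I" "j \<in> J" "k \<in> J" for i j k
    using wells[OF that] by auto
  have eqb: "b i j k = b i' j' k' \<longleftrightarrow> a i j k = a i' j' k'"
    and eqc: "c i j k = c i' j' k' \<longleftrightarrow> a i j k = a i' j' k'"
    if "i \<in> I" "j \<in> J" "k \<in> J" "i' \<in> I" "j' \<in> J" "k' \<in> J" for i j k i' j' k'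
    using wells_determined[OF \<eta>(1,2) wells[OF that(1-3)] wells[OF that(4-6)]] by this+
  have s23: "(a i j k = a i j' k \<and> a i j k' = a i j' k') \<or> (a i j k = a i j k' \<and> a i j' k = a i j' k')"
    if "i \<in> I" "j \<in> J" "j' \<in> J" "k \<in> J" "k' \<in> J" for i j j' k k'
    by (rule sidon[OF _ d23[OF that]]) (use mem that in simp)
  have s13: "(a i j k = a i' j k \<and> a i j k' = a i' j k') \<or> (a i j k = a i j k' \<and> a i' j k = a i' j k')"
    if t: "i \<in> I" "i' \<in> I" "j \<in> J" "k \<in> J" "k' \<in> J" for i i' j k k'
  proof -
    have "(b i j k = b i' j k \<and> b i j k' = b i' j k') \<or> (b i j k = b i j k' \<and> b i' j k = b i' j k')"
      by (rule sidon[OF _ d13[OF t]]) (use mem t in simp)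
    then show ?thesis by (simp only: eqb t)
  qed
  have s12: "(a i j k = a i' j k \<and> a i j' k = a i' j' k) \<or> (a i j k = a i j' k \<and> a i' j k = a i' j' k)"
    if t: "i \<in> I" "i' \<in> I" "j \<in> J" "j' \<in> J" "k \<in> J" for i i' j j' k
  proof -
    have "(c i j k = c i' j k \<and> c i j' k = c i' j' k) \<or> (c i j k = c i j' k \<and> c i' j k = c i' j' k)"
      by (rule sidon[OF _ d12[OF t]]) (use mem t in simp)
    then show ?thesis by (simp only: eqc t)
  qed
  have IJ: "0 \<in> I" "1 \<in> I" "2 \<in> I" "0 \<in> J" "1 \<in> J" "-1 \<in> J"
    by (simp_all add: I_def J_def)
  have D: "(a 0 0 0 = a 1 1 1 \<and> a 1 (- 1) (- 1) = a 2 0 0) \<or> (a 0 0 0 = a 1 (- 1) (- 1) \<and> a 1 1 1 = a 2 0 0)"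
    by (rule sidon[OF _ diag]) (use mem IJ in simp)
  have "(\<forall>i\<in>I. \<forall>j\<in>J. \<forall>j'\<in>J. \<forall>k\<in>J. \<forall>k'\<in>J. a i j k = a i j' k')
    \<or> (\<forall>i\<in>I. \<forall>i'\<in>I. \<forall>j\<in>J. \<forall>k\<in>J. \<forall>k'\<in>J. a i j k = a i' j k')
    \<or> (\<forall>i\<in>I. \<forall>i'\<in>I. \<forall>j\<in>J. \<forall>j'\<in>J. \<forall>k\<in>J. a i j k = a i' j' k)"
    by (rule depends_on_one_of_three) (erule (4) s12 s13 s23)+
  then have "a 1 0 0 = a 0 0 0 \<and> a 0 1 0 = a 0 0 0 \<and> a 0 0 1 = a 0 0 0"
  proof (elim disjE)
    assume i: "\<forall>i\<in>I. \<forall>j\<in>J. \<forall>j'\<in>J. \<forall>k\<in>J. \<forall>k'\<in>J. a i j k = a i j' k'"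
    then have "a 1 1 1 = a 1 0 0" "a 1 (- 1) (- 1) = a 1 0 0" "a 0 1 0 = a 0 0 0" "a 0 0 1 = a 0 0 0"
      using IJ by blast+
    then show ?thesis using D by metis
  next
    assume j: "\<forall>i\<in>I. \<forall>i'\<in>I. \<forall>j\<in>J. \<forall>k\<in>J. \<forall>k'\<in>J. a i j k = a i' j k'"
    then have "a 1 1 1 = a 0 1 0" "a 2 0 0 = a 0 0 0" "a 1 0 0 = a 0 0 0" "a 0 0 1 = a 0 0 0"
      using IJ by blast+
    then show ?thesis using D by metis
  next
    assume k: "\<forall>i\<in>I. \<forall>i'\<in>I. \<forall>j\<in>J. \<forall>j'\<in>J. \<forall>k\<in>J. a i j k = a i' j' k"
    then have "a 1 1 1 = a 0 0 1" "a 2 0 0 = a 0 0 0" "a 1 0 0 = a 0 0 0" "a 0 1 0 = a 0 0 0"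
      using IJ by blast+
    then show ?thesis using D by metis
  qed
  then show "a 1 0 0 = a 0 0 0" "a 0 1 0 = a 0 0 0" "a 0 0 1 = a 0 0 0" by blast+
qed

section \<open>Invariance under small shifts\<close>

definition lattice_point :: "real \<Rightarrow> int \<Rightarrow> int \<Rightarrow> int \<Rightarrow> real^3" where
  "lattice_point h i j k = (h * of_int i) *\<^sub>R axis 1 1 + (h * of_int j) *\<^sub>R axis 2 1 + (h * of_int k) *\<^sub>R axis 3 1"

lemma norm_lattice_point:
  assumes "\<bar>h\<bar> \<le> r" "i \<in> {0, 1, 2}" "j \<in> {-1, 0, 1}" "k \<in> {-1, 0, 1}"
  shows "norm (lattice_point h i j k) \<le> 4 * r"
proof -
  have "norm (lattice_point h i j k)
    \<le> norm ((h * of_int i) *\<^sub>R axis 1 1 :: real^3) + norm ((h * of_int j) *\<^sub>R axis 2 1 :: real^3) + norm ((h * of_int k) *\<^sub>R axis 3 1 :: real^3)"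
    unfolding lattice_point_def by (intro norm_triangle_le add_mono order_refl)
  also have "\<dots> = \<bar>h\<bar> * \<bar>of_int i\<bar> + \<bar>h\<bar> * \<bar>of_int j\<bar> + \<bar>h\<bar> * \<bar>of_int k\<bar>"
    by (simp add: norm_axis_1 abs_mult)
  also have "\<dots> \<le> r * 2 + r * 1 + r * 1"
    using assms by (intro add_mono mult_mono) auto
  finally show ?thesis by simp
qed

text \<open>
  For almost every \<open>x\<close> all the parallelogram identities hold simultaneously on the grid of mesh \<open>h\<close> around
  \<open>x\<close>, since there are only countably many of them; then \<open>grid_rigidity\<close> applies.  The larger ball
  has radius \<open>5 * r\<close> because grid points are at distance at most \<open>4 * r\<close> from \<open>x\<close>.
\<close>
lemma shift_invariant:
  fixes A B C :: "real^3 \<Rightarrow> real"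
  assumes \<eta>: "\<eta>2 < \<eta>1" "\<eta>1 < \<eta>3" "\<eta>2 + \<eta>3 \<noteq> 2 * \<eta>1"
    and int: "integrable lborel A" "integrable lborel B" "integrable lborel C"
    and h: "\<bar>h\<bar> \<le> r"
    and wells: "AE x in lborel. x \<in> ball x0 (5 * r) \<longrightarrow>
      (A x, B x, C x) \<in> {(\<eta>3, \<eta>1, \<eta>2), (\<eta>2, \<eta>3, \<eta>1), (\<eta>1, \<eta>2, \<eta>3)}"
    and A23: "\<And>\<phi>. test_function (ball x0 (5 * r)) \<phi> \<Longrightarrow>
      (LINT x|lborel. A x * dderiv (axis 2 1) (dderiv (axis 3 1) \<phi>) x) = 0"
    and B13: "\<And>\<phi>. test_function (ball x0 (5 * r)) \<phi> \<Longrightarrow>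
      (LINT x|lborel. B x * dderiv (axis 1 1) (dderiv (axis 3 1) \<phi>) x) = 0"
    and C12: "\<And>\<phi>. test_function (ball x0 (5 * r)) \<phi> \<Longrightarrow>
      (LINT x|lborel. C x * dderiv (axis 1 1) (dderiv (axis 2 1) \<phi>) x) = 0"
    and wave: "\<And>\<phi>. test_function (ball x0 (5 * r)) \<phi> \<Longrightarrow>
      (LINT x|lborel. A x * dderiv (axis 1 1 + axis 2 1 + axis 3 1)
        (dderiv (axis 1 1 - axis 2 1 - axis 3 1) \<phi>) x) = 0"
  shows "AE x in lborel. x \<in> ball x0 r \<longrightarrow> A (h *\<^sub>R axis m 1 + x) = A x"
proof -
  let ?U = "ball x0 (5 * r)"
  let ?P = "\<lambda>i j k x. lattice_point h i j k + x"
  have a0: "AE x in lborel. x \<in> ?U \<and> x + s *\<^sub>R axis 2 1 \<in> ?U \<and> x + t *\<^sub>R axis 3 1 \<in> ?U \<and> x + s *\<^sub>R axis 2 1 + t *\<^sub>R axis 3 1 \<in> ?U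
      \<longrightarrow> A x + A (x + s *\<^sub>R axis 2 1 + t *\<^sub>R axis 3 1) = A (x + s *\<^sub>R axis 2 1) + A (x + t *\<^sub>R axis 3 1)" for s t
    by (rule second_difference_scaled[OF int(1) open_ball convex_ball A23])
  have b0: "AE x in lborel. x \<in> ?U \<and> x + s *\<^sub>R axis 1 1 \<in> ?U \<and> x + t *\<^sub>R axis 3 1 \<in> ?U \<and> x + s *\<^sub>R axis 1 1 + t *\<^sub>R axis 3 1 \<in> ?U
      \<longrightarrow> B x + B (x + s *\<^sub>R axis 1 1 + t *\<^sub>R axis 3 1) = B (x + s *\<^sub>R axis 1 1) + B (x + t *\<^sub>R axis 3 1)" for s t
    by (rule second_difference_scaled[OF int(2) open_ball convex_ball B13])
  have c0: "AE x in lborel. x \<in> ?U \<and> x + s *\<^sub>R axis 1 1 \<in> ?U \<and> x + t *\<^sub>R axis 2 1 \<in> ?U \<and> x + s *\<^sub>R axis 1 1 + t *\<^sub>R axis 2 1 \<in> ?U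
      \<longrightarrow> C x + C (x + s *\<^sub>R axis 1 1 + t *\<^sub>R axis 2 1) = C (x + s *\<^sub>R axis 1 1) + C (x + t *\<^sub>R axis 2 1)" for s t
    by (rule second_difference_scaled[OF int(3) open_ball convex_ball C12])
  have w: "AE x in lborel. \<forall>i j k. ?P i j k x \<in> ?U \<longrightarrow>
      (A (?P i j k x), B (?P i j k x), C (?P i j k x)) \<in> {(\<eta>3, \<eta>1, \<eta>2), (\<eta>2, \<eta>3, \<eta>1), (\<eta>1, \<eta>2, \<eta>3)}"
    unfolding AE_all_countable by (intro allI AE_lborel_translate[OF wells])
  have a: "AE x in lborel. \<forall>i j j' k k'. ?P i j k x \<in> ?U \<and> ?P i j' k x \<in> ?U \<and> ?P i j k' x \<in> ?U \<and> ?P i j' k' x \<in> ?U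
      \<longrightarrow> A (?P i j k x) + A (?P i j' k' x) = A (?P i j' k x) + A (?P i j k' x)"
    unfolding AE_all_countable
  proof (intro allI)
    fix i j j' k k' :: int
    have e: "?P i j k x + (h * of_int (j' - j)) *\<^sub>R axis 2 1 = ?P i j' k x"
      "?P i j k x + (h * of_int (k' - k)) *\<^sub>R axis 3 1 = ?P i j k' x"
      "?P i j' k x + (h * of_int (k' - k)) *\<^sub>R axis 3 1 = ?P i j' k' x" for x
      by (simp_all add: lattice_point_def algebra_simps)
    show "AE x in lborel. ?P i j k x \<in> ?U \<and> ?P i j' k x \<in> ?U \<and> ?P i j k' x \<in> ?U \<and> ?P i j' k' x \<in> ?U
      \<longrightarrow> A (?P i j k x) + A (?P i j' k' x) = A (?P i j' k x) + A (?P i j k' x)"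
      using AE_lborel_translate[OF a0[of "h * of_int (j' - j)" "h * of_int (k' - k)"], of "lattice_point h i j k"]
      unfolding e .
  qed
  have b: "AE x in lborel. \<forall>i i' j k k'. ?P i j k x \<in> ?U \<and> ?P i' j k x \<in> ?U \<and> ?P i j k' x \<in> ?U \<and> ?P i' j k' x \<in> ?U
      \<longrightarrow> B (?P i j k x) + B (?P i' j k' x) = B (?P i' j k x) + B (?P i j k' x)"
    unfolding AE_all_countable
  proof (intro allI)
    fix i i' j k k' :: int
    have e: "?P i j k x + (h * of_int (i' - i)) *\<^sub>R axis 1 1 = ?P i' j k x"
      "?P i j k x + (h * of_int (k' - k)) *\<^sub>R axis 3 1 = ?P i j k' x"
      "?P i' j k x + (h * of_int (k' - k)) *\<^sub>R axis 3 1 = ?P i' j k' x" for x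
      by (simp_all add: lattice_point_def algebra_simps)
    show "AE x in lborel. ?P i j k x \<in> ?U \<and> ?P i' j k x \<in> ?U \<and> ?P i j k' x \<in> ?U \<and> ?P i' j k' x \<in> ?U
      \<longrightarrow> B (?P i j k x) + B (?P i' j k' x) = B (?P i' j k x) + B (?P i j k' x)"
      using AE_lborel_translate[OF b0[of "h * of_int (i' - i)" "h * of_int (k' - k)"], of "lattice_point h i j k"]
      unfolding e .
  qed
  have c: "AE x in lborel. \<forall>i i' j j' k. ?P i j k x \<in> ?U \<and> ?P i' j k x \<in> ?U \<and> ?P i j' k x \<in> ?U \<and> ?P i' j' k x \<in> ?U
      \<longrightarrow> C (?P i j k x) + C (?P i' j' k x) = C (?P i' j k x) + C (?P i j' k x)"
    unfolding AE_all_countable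
  proof (intro allI)
    fix i i' j j' k :: int
    have e: "?P i j k x + (h * of_int (i' - i)) *\<^sub>R axis 1 1 = ?P i' j k x"
      "?P i j k x + (h * of_int (j' - j)) *\<^sub>R axis 2 1 = ?P i j' k x"
      "?P i' j k x + (h * of_int (j' - j)) *\<^sub>R axis 2 1 = ?P i' j' k x" for x
      by (simp_all add: lattice_point_def algebra_simps)
    show "AE x in lborel. ?P i j k x \<in> ?U \<and> ?P i' j k x \<in> ?U \<and> ?P i j' k x \<in> ?U \<and> ?P i' j' k x \<in> ?U
      \<longrightarrow> C (?P i j k x) + C (?P i' j' k x) = C (?P i' j k x) + C (?P i j' k x)"
      using AE_lborel_translate[OF c0[of "h * of_int (i' - i)" "h * of_int (j' - j)"], of "lattice_point h i j k"]
      unfolding e .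
  qed
  have d: "AE x in lborel. ?P 0 0 0 x \<in> ?U \<and> ?P 1 1 1 x \<in> ?U \<and> ?P 1 (- 1) (- 1) x \<in> ?U \<and> ?P 2 0 0 x \<in> ?U
      \<longrightarrow> A (?P 0 0 0 x) + A (?P 2 0 0 x) = A (?P 1 1 1 x) + A (?P 1 (- 1) (- 1) x)"
  proof -
    have e: "?P 0 0 0 x = x"
      "?P 1 1 1 x = x + h *\<^sub>R (axis 1 1 + axis 2 1 + axis 3 1)"
      "?P 1 (- 1) (- 1) x = x + h *\<^sub>R (axis 1 1 - axis 2 1 - axis 3 1)"
      "?P 2 0 0 x = x + h *\<^sub>R (axis 1 1 + axis 2 1 + axis 3 1) + h *\<^sub>R (axis 1 1 - axis 2 1 - axis 3 1)" for x
      by (simp_all add: lattice_point_def algebra_simps flip: scaleR_2)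
    show ?thesis
      unfolding e by (rule second_difference_scaled[OF int(1) open_ball convex_ball wave])
  qed
  show ?thesis
    using w a b c d
  proof eventually_elim
    case (elim x)
    show ?case
    proof
      assume x: "x \<in> ball x0 r"
      have U: "?P i j k x \<in> ?U" if "i \<in> {0, 1, 2}" "j \<in> {-1, 0, 1}" "k \<in> {-1, 0, 1}" for i j k
      proof -
        have "dist x0 (?P i j k x) \<le> dist x0 x + norm (lattice_point h i j k)"
          using dist_triangle[of x0 "?P i j k x" x] by (simp add: dist_norm norm_minus_commute)
        also have "\<dots> < r + 4 * r"
          using x norm_lattice_point[OF h that] by simp
        finally show ?thesis by simp
      qed
      have pm: "0 \<in> {0, 1, 2::int}" "1 \<in> {0, 1, 2::int}" "2 \<in> {0, 1, 2::int}"
        "0 \<in> {-1, 0, 1::int}" "1 \<in> {-1, 0, 1::int}" "-1 \<in> {-1, 0, 1::int}" by simp_all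
      have "A (?P 1 0 0 x) = A (?P 0 0 0 x)" "A (?P 0 1 0 x) = A (?P 0 0 0 x)" "A (?P 0 0 1 x) = A (?P 0 0 0 x)"
      proof -
        have w': "(A (?P i j k x), B (?P i j k x), C (?P i j k x)) \<in> {(\<eta>3, \<eta>1, \<eta>2), (\<eta>2, \<eta>3, \<eta>1), (\<eta>1, \<eta>2, \<eta>3)}"
          if "i \<in> {0, 1, 2}" "j \<in> {-1, 0, 1}" "k \<in> {-1, 0, 1}" for i j k
          using elim(1)[rule_format] U[OF that] by blast
        have a': "A (?P i j k x) + A (?P i j' k' x) = A (?P i j' k x) + A (?P i j k' x)"
          if "i \<in> {0, 1, 2}" "j \<in> {-1, 0, 1}" "j' \<in> {-1, 0, 1}" "k \<in> {-1, 0, 1}" "k' \<in> {-1, 0, 1}" for i j j' k k'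
          by (rule elim(2)[rule_format]) (intro conjI U that)
        have b': "B (?P i j k x) + B (?P i' j k' x) = B (?P i' j k x) + B (?P i j k' x)"
          if "i \<in> {0, 1, 2}" "i' \<in> {0, 1, 2}" "j \<in> {-1, 0, 1}" "k \<in> {-1, 0, 1}" "k' \<in> {-1, 0, 1}" for i i' j k k'
          by (rule elim(3)[rule_format]) (intro conjI U that)
        have c': "C (?P i j k x) + C (?P i' j' k x) = C (?P i' j k x) + C (?P i j' k x)"
          if "i \<in> {0, 1, 2}" "i' \<in> {0, 1, 2}" "j \<in> {-1, 0, 1}" "j' \<in> {-1, 0, 1}" "k \<in> {-1, 0, 1}" for i i' j j' k
          by (rule elim(4)[rule_format]) (intro conjI U that)
        have d': "A (?P 0 0 0 x) + A (?P 2 0 0 x) = A (?P 1 1 1 x) + A (?P 1 (- 1) (- 1) x)"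
          by (rule elim(5)[rule_format]) (intro conjI U pm)
        note G = grid_rigidity[where a = "\<lambda>i j k. A (?P i j k x)" and b = "\<lambda>i j k. B (?P i j k x)"
            and c = "\<lambda>i j k. C (?P i j k x)", OF \<eta> w' a' b' c' d']
        show "A (?P 1 0 0 x) = A (?P 0 0 0 x)" by (rule G(1))
        show "A (?P 0 1 0 x) = A (?P 0 0 0 x)" by (rule G(2))
        show "A (?P 0 0 1 x) = A (?P 0 0 0 x)" by (rule G(3))
      qed
      then have "A (h *\<^sub>R axis 1 1 + x) = A x" "A (h *\<^sub>R axis 2 1 + x) = A x" "A (h *\<^sub>R axis 3 1 + x) = A x"
        by (simp_all add: lattice_point_def)
      then show "A (h *\<^sub>R axis m 1 + x) = A x"
        using exhaust_3[of m] by auto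
    qed
  qed
qed

section \<open>Compatibility of strains\<close>

text \<open>
  Replaces a Lebesgue measurable function on an arbitrary domain by an integrable Borel function on
  the whole space, as long as it is tested inside \<open>K\<close>.
\<close>
lemma borel_representative:
  fixes f :: "'a::euclidean_space \<Rightarrow> real"
  assumes "f absolutely_integrable_on K" "K \<subseteq> \<Omega>" "\<Omega> \<in> sets lebesgue"
  shows "\<exists>F. integrable lborel F \<and> (AE x in lborel. x \<in> K \<longrightarrow> F x = f x) \<and>
    (\<forall>\<phi>. test_function K \<phi> \<longrightarrow> (LINT x|lebesgue_on \<Omega>. f x * \<phi> x) = (LINT x|lborel. F x * \<phi> x))"
proof -
  have int: "integrable lebesgue (\<lambda>x. indicator K x *\<^sub>R f x)"
    using assms(1) by (simp add: set_integrable_def)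
  then have "(\<lambda>x. indicator K x *\<^sub>R f x) \<in> borel_measurable (completion lborel)" by simp
  then obtain F where F: "F \<in> borel_measurable lborel" "AE x in lborel. indicator K x *\<^sub>R f x = F x"
    using completion_ex_borel_measurable_real by blast
  have mF: "F \<in> borel_measurable lebesgue" using F(1) by (rule measurable_completion)
  have AE: "AE x in lebesgue. indicator K x *\<^sub>R f x = F x" using F(2) by (rule AE_completion)
  have "integrable lebesgue F"
    by (rule integrable_cong_AE_imp[OF int mF]) (use AE in \<open>auto elim!: eventually_mono\<close>)
  then have 1: "integrable lborel F" using F(1) by (simp add: integrable_completion)
  have 2: "AE x in lborel. x \<in> K \<longrightarrow> F x = f x"
    using F(2) by eventually_elim auto
  have 3: "(LINT x|lebesgue_on \<Omega>. f x * \<phi> x) = (LINT x|lborel. F x * \<phi> x)" if \<phi>: "test_function K \<phi>" for \<phi>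
  proof -
    have z: "\<phi> x = 0" if "x \<notin> K" for x
      using test_function_support[OF \<phi>] that by blast
    have m: "\<phi> \<in> borel_measurable borel" using \<phi> by (rule test_function_measurable)
    have "(LINT x|lebesgue_on \<Omega>. f x * \<phi> x) = (LINT x|lebesgue. indicator \<Omega> x *\<^sub>R (f x * \<phi> x))"
      using assms(3) by (intro integral_restrict_space) simp
    also have "\<dots> = (LINT x|lebesgue. (indicator K x *\<^sub>R f x) * \<phi> x)"
    proof (intro Bochner_Integration.integral_cong refl)
      fix x show "indicator \<Omega> x *\<^sub>R (f x * \<phi> x) = (indicator K x *\<^sub>R f x) * \<phi> x"
        using z[of x] assms(2) by (cases "x \<in> K") auto
    qed
    also have "\<dots> = (LINT x|lebesgue. F x * \<phi> x)"
    proof (rule integral_cong_AE)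
      have "\<phi> \<in> borel_measurable lebesgue" by (rule measurable_completion) (use m in simp)
      then show "(\<lambda>x. (indicator K x *\<^sub>R f x) * \<phi> x) \<in> borel_measurable lebesgue"
        "(\<lambda>x. F x * \<phi> x) \<in> borel_measurable lebesgue"
        using int mF by (auto intro!: borel_measurable_times)
      show "AE x in lebesgue. (indicator K x *\<^sub>R f x) * \<phi> x = F x * \<phi> x"
        using AE by eventually_elim simp
    qed
    also have "\<dots> = (LINT x|lborel. F x * \<phi> x)"
      using F(1) m by (intro integral_completion) simp
    finally show ?thesis .
  qed
  from 1 2 3 show ?thesis by blast
qed

text \<open>
  Compatibility of a strain with vanishing off-diagonal part.  Here \<open>T i\<close> stands for integration against
  the \<open>i\<close>-th displacement component and \<open>M i j\<close> for integration against its \<open>j\<close>-th derivative.  Vanishing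
  off-diagonal strain lets a derivative be traded, \<open>T i (\<partial>\<^sub>j f) = - T j (\<partial>\<^sub>i f)\<close>.  One trade gives the
  first claim.  For distinct indices, three trades lead from \<open>T i\<close> through \<open>T j\<close> and
  \<open>T k\<close> back to \<open>T i\<close>, with the sign reversed.
\<close>
lemma saint_venant:
  fixes T :: "'n::finite \<Rightarrow> ((real^'n) \<Rightarrow> real) \<Rightarrow> real" and M :: "'n \<Rightarrow> 'n \<Rightarrow> ((real^'n) \<Rightarrow> real) \<Rightarrow> real"
  assumes weak: "\<And>i j \<phi>. test_function U \<phi> \<Longrightarrow> T i (dderiv (axis j 1) \<phi>) = - M i j \<phi>"
    and skew: "\<And>i j \<phi>. i \<noteq> j \<Longrightarrow> test_function U \<phi> \<Longrightarrow> M i j \<phi> = - M j i \<phi>"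
    and \<phi>: "test_function U \<phi>"
  defines "D \<equiv> \<lambda>j. dderiv (axis j 1 :: real^'n)"
  shows "i \<noteq> j \<Longrightarrow> M i i (D j (D j \<phi>)) = - M j j (D i (D i \<phi>))"
    and "i \<noteq> j \<Longrightarrow> i \<noteq> k \<Longrightarrow> j \<noteq> k \<Longrightarrow> M i i (D j (D k \<phi>)) = 0"
proof -
  have t: "test_function U (D a f)" if "test_function U f" for a f
    unfolding D_def using that by (rule test_function_dderiv)
  have comm: "D a (D b f) = D b (D a f)" if "test_function U f" for a b f
    unfolding D_def by (rule ext) (rule dderiv_commute[OF test_function_smooth[OF that]])
  have w: "M a b f = - T a (D b f)" if "test_function U f" for a b f
    using weak[OF that] by (simp add: D_def)
  have s: "T a (D b f) = - T b (D a f)" if "a \<noteq> b" "test_function U f" for a b f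
    using skew[OF that] w[OF that(2)] by simp
  note t2 = t[OF t[OF \<phi>]]
  show "M i i (D j (D j \<phi>)) = - M j j (D i (D i \<phi>))" if ij: "i \<noteq> j"
  proof -
    have "T i (D i (D j (D j \<phi>))) = T i (D j (D i (D j \<phi>)))"
      by (simp only: comm[OF t[OF \<phi>], of i j])
    also have "\<dots> = - T j (D i (D i (D j \<phi>)))"
      by (rule s[OF ij t2])
    also have "D i (D i (D j \<phi>)) = D j (D i (D i \<phi>))"
      by (simp only: comm[OF \<phi>, of i j] comm[OF t[OF \<phi>], of i j])
    finally show ?thesis using w[OF t2] by simp
  qed
  show "M i i (D j (D k \<phi>)) = 0" if d: "i \<noteq> j" "i \<noteq> k" "j \<noteq> k"
  proof -
    have "T i (D i (D j (D k \<phi>))) = T i (D j (D i (D k \<phi>)))"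
      by (simp only: comm[OF t[OF \<phi>], of i j])
    also have "\<dots> = - T j (D i (D i (D k \<phi>)))"
      by (rule s[OF d(1) t2])
    also have "D i (D i (D k \<phi>)) = D k (D i (D i \<phi>))"
      by (simp only: comm[OF \<phi>, of i k] comm[OF t[OF \<phi>], of i k])
    also have "- T j (D k (D i (D i \<phi>))) = T k (D j (D i (D i \<phi>)))"
      using s[OF d(3) t2] by simp
    also have "D j (D i (D i \<phi>)) = D i (D j (D i \<phi>))"
      by (rule comm[OF t[OF \<phi>]])
    also have "T k (D i (D j (D i \<phi>))) = - T i (D k (D j (D i \<phi>)))"
      by (rule s[OF _ t2]) (use d in simp)
    also have "D k (D j (D i \<phi>)) = D i (D j (D k \<phi>))"
    proof -
      have "D k (D j (D i \<phi>)) = D k (D i (D j \<phi>))" by (simp only: comm[OF \<phi>, of i j])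
      also have "\<dots> = D i (D k (D j \<phi>))" by (rule comm[OF t[OF \<phi>]])
      also have "\<dots> = D i (D j (D k \<phi>))" by (simp only: comm[OF \<phi>, of k j])
      finally show ?thesis .
    qed
    finally show ?thesis using w[OF t2] by simp
  qed
qed

text \<open>
  The factorisation of the wave operator, up to a mixed derivative: \<open>a\<^sup>2 - (b + c)\<^sup>2\<close> is the product of
  \<open>a + b + c\<close> and \<open>a - b - c\<close>.
\<close>
lemma wave_operator:
  fixes \<phi> :: "real^3 \<Rightarrow> real"
  defines "D \<equiv> \<lambda>j. dderiv (axis j 1 :: real^3)"
  assumes sm: "smooth \<phi>"
  shows "dderiv (axis 1 1 + axis 2 1 + axis 3 1) (dderiv (axis 1 1 - axis 2 1 - axis 3 1) \<phi>) x
    = D 1 (D 1 \<phi>) x - D 2 (D 2 \<phi>) x - D 3 (D 3 \<phi>) x - 2 * D 2 (D 3 \<phi>) x"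
proof -
  have lin: "linear (frechet_derivative f (at x))" if "smooth f" for f :: "real^3 \<Rightarrow> real" and x
    using smooth_has_derivative[OF that, of x]
    by (simp add: bounded_linear.linear has_derivative_bounded_linear)
  have "dderiv (axis 1 1 - axis 2 1 - axis 3 1) \<phi> y = D 1 \<phi> y - D 2 \<phi> y - D 3 \<phi> y" for y
    using lin[OF sm] by (simp add: D_def linear_diff)
  moreover have "((\<lambda>y. D 1 \<phi> y - D 2 \<phi> y - D 3 \<phi> y) has_derivative
      (\<lambda>h. frechet_derivative (D 1 \<phi>) (at x) h - frechet_derivative (D 2 \<phi>) (at x) h - frechet_derivative (D 3 \<phi>) (at x) h)) (at x)"
    unfolding D_def by (intro has_derivative_diff smooth_has_derivative smooth_dderiv sm)
  ultimately have "dderiv b (dderiv (axis 1 1 - axis 2 1 - axis 3 1) \<phi>) x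
      = dderiv b (D 1 \<phi>) x - dderiv b (D 2 \<phi>) x - dderiv b (D 3 \<phi>) x" for b
    using dderiv_eqI by (simp only:) 
  moreover have "dderiv (axis 1 1 + axis 2 1 + axis 3 1) (D m \<phi>) x = D 1 (D m \<phi>) x + D 2 (D m \<phi>) x + D 3 (D m \<phi>) x" for m
    using lin[OF smooth_dderiv[OF sm]] by (simp add: D_def linear_add)
  moreover have "D a (D b \<phi>) x = D b (D a \<phi>) x" for a b
    unfolding D_def by (rule dderiv_commute[OF sm])
  note this[of 2 1] this[of 3 1] this[of 3 2]
  ultimately show ?thesis by simp
qed

lemma sym_part_in_K3:
  assumes "sym_part A \<in> K3 \<eta>1 \<eta>2 \<eta>3"
  shows "(A $ 1 $ 1, A $ 2 $ 2, A $ 3 $ 3) \<in> {(\<eta>3, \<eta>1, \<eta>2), (\<eta>2, \<eta>3, \<eta>1), (\<eta>1, \<eta>2, \<eta>3)}"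
    and "i \<noteq> j \<Longrightarrow> A $ i $ j = - A $ j $ i"
proof -
  have s: "sym_part A $ a $ b = (A $ a $ b + A $ b $ a) / 2" for a b
    by (simp add: sym_part_def transpose_def)
  have d: "diag_matrix v $ a $ b = (if a = b then v $ a else 0)" for v :: "real^3" and a b
    by (simp add: diag_matrix_def)
  obtain v where v: "sym_part A = diag_matrix v"
    "v \<in> {vector [\<eta>3, \<eta>1, \<eta>2], vector [\<eta>2, \<eta>3, \<eta>1], vector [\<eta>1, \<eta>2, \<eta>3]}"
    using assms unfolding K3_def by blast
  have diag: "A $ a $ a = v $ a" for a
    using s[of a a] d[of v a a] v(1) by simp
  show "(A $ 1 $ 1, A $ 2 $ 2, A $ 3 $ 3) \<in> {(\<eta>3, \<eta>1, \<eta>2), (\<eta>2, \<eta>3, \<eta>1), (\<eta>1, \<eta>2, \<eta>3)}"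
    unfolding diag using v(2) by (elim insertE emptyE) (simp_all add: vector_3)
  show "A $ i $ j = - A $ j $ i" if "i \<noteq> j"
    using s[of i j] d[of v i j] v(1) that by simp
qed

text \<open>
  Inside a ball the distributional derivatives of \<open>u\<close> are represented by integrable functions, to which
  the compatibility conditions and \<open>shift_invariant\<close> apply.
\<close>
lemma strain_locally_constant:
  fixes u :: "real^3 \<Rightarrow> real^3"
  assumes \<eta>: "\<eta>2 < \<eta>1" "\<eta>1 < \<eta>3" "\<eta>2 + \<eta>3 \<noteq> 2 * \<eta>1"
    and \<Omega>: "open \<Omega>" and x0: "x0 \<in> \<Omega>"
    and grad: "has_weak_gradient \<Omega> u Du"
    and K3: "AE x in lborel. x \<in> \<Omega> \<longrightarrow> sym_part (Du x) \<in> K3 \<eta>1 \<eta>2 \<eta>3"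
  shows "\<exists>\<delta>>0. \<exists>c. AE x in lborel. x \<in> ball x0 \<delta> \<longrightarrow> Du x $ 1 $ 1 = c"
proof -
  obtain R where R: "0 < R" "cball x0 R \<subseteq> \<Omega>"
    using \<Omega> x0 open_contains_cball by blast
  \<comment> \<open>The factor 5 makes \<open>U\<close> the ball of radius \<open>5 * r\<close> required by \<open>shift_invariant\<close>.\<close>
  define r K U where "r = R / 5" and "K = cball x0 R" and "U = ball x0 (5 * r)"
  have r: "0 < r" using R(1) by (simp add: r_def)
  have UK: "U \<subseteq> K" and U\<Omega>: "U \<subseteq> \<Omega>"
    using R(2) ball_subset_cball[of x0 R] by (auto simp: U_def K_def r_def)
  have wd: "has_weak_derivative \<Omega> (\<lambda>x. u x $ i) (axis j 1) (\<lambda>x. Du x $ i $ j)" for i j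
    using grad by (simp add: has_weak_gradient_def)
  define rep where "rep i j G \<longleftrightarrow> integrable lborel G \<and> (AE x in lborel. x \<in> K \<longrightarrow> G x = Du x $ i $ j) \<and>
    (\<forall>\<phi>. test_function K \<phi> \<longrightarrow> (LINT x|lebesgue_on \<Omega>. Du x $ i $ j * \<phi> x) = (LINT x|lborel. G x * \<phi> x))"
    for i j G
  have "\<exists>G. rep i j G" for i j
    unfolding rep_def
  proof (rule borel_representative)
    show "(\<lambda>x. Du x $ i $ j) absolutely_integrable_on K"
      using wd[of i j] R(2) by (simp add: has_weak_derivative_def locally_integrable_def K_def)
  qed (use R(2) \<Omega> in \<open>auto simp: K_def\<close>)
  then have rep: "rep i j (SOME G. rep i j G)" for i j
    by (rule someI_ex)
  define F where "F = (\<lambda>i j. SOME G. rep i j G)"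
  have F: "integrable lborel (F i j)" and F_eq: "AE x in lborel. x \<in> K \<longrightarrow> F i j x = Du x $ i $ j" for i j
    using rep[of i j] by (simp_all only: rep_def F_def)
  have F_int: "(LINT x|lebesgue_on \<Omega>. Du x $ i $ j * \<phi> x) = (LINT x|lborel. F i j x * \<phi> x)"
    if "test_function K \<phi>" for i j \<phi>
    using rep[of i j] that by (simp only: rep_def F_def)
  define T where "T = (\<lambda>i \<phi>. LINT x|lebesgue_on \<Omega>. u x $ i * \<phi> x)"
  define M where "M = (\<lambda>i j \<phi>. LINT x|lborel. F i j x * \<phi> x)"
  have weak: "T i (dderiv (axis j 1) \<phi>) = - M i j \<phi>" if "test_function U \<phi>" for i j \<phi>
    using wd[of i j] test_function_mono[OF that U\<Omega>] F_int[OF test_function_mono[OF that UK], of i j]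
    by (simp add: has_weak_derivative_def T_def M_def)
  have skew: "M i j \<phi> = - M j i \<phi>" if "i \<noteq> j" "test_function U \<phi>" for i j \<phi>
  proof -
    have z: "\<phi> x = 0" if "x \<notin> U" for x
      using test_function_support[OF \<open>test_function U \<phi>\<close>] that by blast
    have "M i j \<phi> = (LINT x|lborel. - (F j i x * \<phi> x))"
      unfolding M_def
    proof (rule integral_cong_AE)
      show "AE x in lborel. F i j x * \<phi> x = - (F j i x * \<phi> x)"
        using F_eq[of i j] F_eq[of j i] K3
      proof eventually_elim
        case (elim x)
        show ?case
        proof (cases "x \<in> U")
          case True
          then have "F i j x = Du x $ i $ j" "F j i x = Du x $ j $ i" "Du x $ i $ j = - Du x $ j $ i"
            using elim UK U\<Omega> sym_part_in_K3(2)[OF _ that(1)] by blast+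
          then show ?thesis by simp
        qed (simp add: z)
      qed
    qed (use F[of i j] F[of j i] test_function_measurable[OF that(2)] in auto)
    then show ?thesis by (simp add: M_def)
  qed
  have wells: "AE x in lborel. x \<in> U \<longrightarrow>
      (F 1 1 x, F 2 2 x, F 3 3 x) \<in> {(\<eta>3, \<eta>1, \<eta>2), (\<eta>2, \<eta>3, \<eta>1), (\<eta>1, \<eta>2, \<eta>3)}"
    using F_eq[of 1 1] F_eq[of 2 2] F_eq[of 3 3] K3
  proof eventually_elim
    case (elim x)
    show ?case
    proof
      assume "x \<in> U"
      then have "F 1 1 x = Du x $ 1 $ 1" "F 2 2 x = Du x $ 2 $ 2" "F 3 3 x = Du x $ 3 $ 3"
        "sym_part (Du x) \<in> K3 \<eta>1 \<eta>2 \<eta>3"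
        using elim UK U\<Omega> by blast+
      then show "(F 1 1 x, F 2 2 x, F 3 3 x) \<in> {(\<eta>3, \<eta>1, \<eta>2), (\<eta>2, \<eta>3, \<eta>1), (\<eta>1, \<eta>2, \<eta>3)}"
        using sym_part_in_K3(1) by (simp only:)
    qed
  qed
  have i: "integrable lborel (\<lambda>x. F i j x * \<psi> x)" if "test_function U \<psi>" for i j \<psi>
    using integrable_test_function[OF F that, of i j 0] by simp
  \<comment> \<open>All wells have trace \<open>\<eta>1 + \<eta>2 + \<eta>3\<close>.\<close>
  have trace: "M 1 1 \<psi> + M 2 2 \<psi> + M 3 3 \<psi> = (\<eta>1 + \<eta>2 + \<eta>3) * (LINT x|lborel. \<psi> x)"
    if \<psi>: "test_function U \<psi>" for \<psi>
  proof -
    have z: "\<psi> x = 0" if "x \<notin> U" for x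
      using test_function_support[OF \<psi>] that by blast
    have "M 1 1 \<psi> + M 2 2 \<psi> + M 3 3 \<psi> = (LINT x|lborel. F 1 1 x * \<psi> x + F 2 2 x * \<psi> x + F 3 3 x * \<psi> x)"
      unfolding M_def by (simp only: Bochner_Integration.integral_add Bochner_Integration.integrable_add i[OF \<psi>])
    also have "\<dots> = (LINT x|lborel. (\<eta>1 + \<eta>2 + \<eta>3) * \<psi> x)"
    proof (rule integral_cong_AE)
      show "AE x in lborel. F 1 1 x * \<psi> x + F 2 2 x * \<psi> x + F 3 3 x * \<psi> x = (\<eta>1 + \<eta>2 + \<eta>3) * \<psi> x"
        using wells
      proof eventually_elim
        case (elim x)
        show ?case
        proof (cases "x \<in> U")
          case True
          then have "F 1 1 x + F 2 2 x + F 3 3 x = \<eta>1 + \<eta>2 + \<eta>3"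
            using elim by auto
          then show ?thesis by (simp only: flip: distrib_right)
        qed (simp add: z)
      qed
    qed (use F test_function_measurable[OF \<psi>] in auto)
    also have "\<dots> = (\<eta>1 + \<eta>2 + \<eta>3) * (LINT x|lborel. \<psi> x)"
      by (rule Bochner_Integration.integral_mult_right_zero)
    finally show ?thesis .
  qed
  let ?D = "\<lambda>j. dderiv (axis j 1 :: real^3)"
  have swap: "M i i (?D j (?D j \<phi>)) = - M j j (?D i (?D i \<phi>))"
    if "test_function U \<phi>" "i \<noteq> j" for i j \<phi>
    by (rule saint_venant(1)[where U = U and T = T and M = M]) (erule weak | erule (1) skew | rule that)+
  have cross: "M i i (?D j (?D k \<phi>)) = 0" if "test_function U \<phi>" "i \<noteq> j" "i \<noteq> k" "j \<noteq> k" for i j k \<phi>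
    by (rule saint_venant(2)[where U = U and T = T and M = M]) (erule weak | erule (1) skew | rule that)+
  have wave: "(LINT x|lborel. F 1 1 x * dderiv (axis 1 1 + axis 2 1 + axis 3 1)
        (dderiv (axis 1 1 - axis 2 1 - axis 3 1) \<phi>) x) = 0" if \<phi>: "test_function U \<phi>" for \<phi>
  proof -
    have t: "test_function U (?D a (?D b \<phi>))" for a b
      by (intro test_function_dderiv \<phi>)
    have "F 1 1 x * dderiv (axis 1 1 + axis 2 1 + axis 3 1) (dderiv (axis 1 1 - axis 2 1 - axis 3 1) \<phi>) x
        = F 1 1 x * ?D 1 (?D 1 \<phi>) x - F 1 1 x * ?D 2 (?D 2 \<phi>) x - F 1 1 x * ?D 3 (?D 3 \<phi>) x
          - 2 * (F 1 1 x * ?D 2 (?D 3 \<phi>) x)" for x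
      unfolding wave_operator[OF test_function_smooth[OF \<phi>]] by (simp add: algebra_simps)
    then have "(LINT x|lborel. F 1 1 x * dderiv (axis 1 1 + axis 2 1 + axis 3 1)
        (dderiv (axis 1 1 - axis 2 1 - axis 3 1) \<phi>) x)
      = (LINT x|lborel. F 1 1 x * ?D 1 (?D 1 \<phi>) x - F 1 1 x * ?D 2 (?D 2 \<phi>) x - F 1 1 x * ?D 3 (?D 3 \<phi>) x
          - 2 * (F 1 1 x * ?D 2 (?D 3 \<phi>) x))"
      by (simp only:)
    also have "\<dots> = M 1 1 (?D 1 (?D 1 \<phi>)) - M 1 1 (?D 2 (?D 2 \<phi>)) - M 1 1 (?D 3 (?D 3 \<phi>)) - 2 * M 1 1 (?D 2 (?D 3 \<phi>))"
      unfolding M_def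
      by (simp only: Bochner_Integration.integral_diff Bochner_Integration.integrable_diff
          Bochner_Integration.integral_mult_right_zero Bochner_Integration.integrable_mult_right i[OF t])
    also have "\<dots> = M 1 1 (?D 1 (?D 1 \<phi>)) + M 2 2 (?D 1 (?D 1 \<phi>)) + M 3 3 (?D 1 (?D 1 \<phi>))"
      using swap[OF \<phi>, of 1 2] swap[OF \<phi>, of 1 3] cross[OF \<phi>, of 1 2 3]
      by simp
    also have "\<dots> = 0"
      unfolding trace[OF t] integral_dderiv[OF test_function_dderiv[OF \<phi>]] by simp
    finally show ?thesis .
  qed
  have "AE x in lborel. x \<in> ball x0 r \<longrightarrow> F 1 1 (h *\<^sub>R axis m 1 + x) = F 1 1 x" if "\<bar>h\<bar> \<le> r" for h m
  proof (rule shift_invariant[OF \<eta> F F F that wells[unfolded U_def]])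
    fix \<phi> assume "test_function (ball x0 (5 * r)) \<phi>"
    then have \<phi>: "test_function U \<phi>" by (simp only: U_def)
    show "(LINT x|lborel. F 1 1 x * ?D 2 (?D 3 \<phi>) x) = 0"
      using cross[OF \<phi>, of 1 2 3] by (simp add: M_def)
    show "(LINT x|lborel. F 2 2 x * ?D 1 (?D 3 \<phi>) x) = 0"
      using cross[OF \<phi>, of 2 1 3] by (simp add: M_def)
    show "(LINT x|lborel. F 3 3 x * ?D 1 (?D 2 \<phi>) x) = 0"
      using cross[OF \<phi>, of 3 1 2] by (simp add: M_def)
    show "(LINT x|lborel. F 1 1 x * dderiv (axis 1 1 + axis 2 1 + axis 3 1)
        (dderiv (axis 1 1 - axis 2 1 - axis 3 1) \<phi>) x) = 0"
      by (rule wave[OF \<phi>])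
  qed
  then obtain c where c: "AE x in lborel. x \<in> ball x0 (r / 8) \<longrightarrow> F 1 1 x = c"
    using axis_shift_invariant_imp_const[of "F 1 1" r x0] F[of 1 1] r by auto
  have sub: "ball x0 (r / 8) \<subseteq> K"
    unfolding K_def r_def using R(1) by (intro subset_trans[OF ball_subset_cball] subset_cball) simp
  have "AE x in lborel. x \<in> ball x0 (r / 8) \<longrightarrow> Du x $ 1 $ 1 = c"
    using c F_eq[of 1 1]
  proof eventually_elim
    case (elim x)
    then show ?case using sub by auto
  qed
  then show ?thesis using r by (intro exI[of _ "r / 8"] conjI exI[of _ c]) simp_all
qed

theorem theorem1:
  fixes \<eta>1 \<eta>2 \<eta>3 :: real
    and \<Omega> :: "(real^3) set"
    and u :: "real^3 \<Rightarrow> real^3"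
    and Du :: "real^3 \<Rightarrow> real^3^3"
  assumes "\<eta>2 < \<eta>1" and "\<eta>1 < \<eta>3" and "\<eta>2 + \<eta>3 > 2 * \<eta>1"
    and "bounded \<Omega>" and "simply_connected \<Omega>" and "lipschitz_domain \<Omega>"
    and "u \<in> W1_infinity \<Omega>"
    and "has_weak_gradient \<Omega> u Du"
    and "AE x in lebesgue_on \<Omega>. sym_part (Du x) \<in> K3 \<eta>1 \<eta>2 \<eta>3"
  shows "\<forall>j. \<exists>c. AE x in lebesgue_on \<Omega>. sym_part (Du x) $ j $ j = c"
proof -
  have \<Omega>: "open \<Omega>" "connected \<Omega>"
    using assms(6) by (simp_all add: lipschitz_domain_def)
  have ne: "\<eta>2 + \<eta>3 \<noteq> 2 * \<eta>1" using assms(3) by simp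
  have on_\<Omega>: "(AE x in lebesgue_on \<Omega>. P x) \<longleftrightarrow> (AE x in lborel. x \<in> \<Omega> \<longrightarrow> P x)" for P
    using \<Omega>(1) by (simp add: AE_restrict_space_iff AE_completion_iff)
  have K3: "AE x in lborel. x \<in> \<Omega> \<longrightarrow> sym_part (Du x) \<in> K3 \<eta>1 \<eta>2 \<eta>3"
    using assms(9) by (simp only: on_\<Omega>)
  have "\<exists>c. AE x in lborel. x \<in> \<Omega> \<longrightarrow> Du x $ 1 $ 1 = c"
    by (rule locally_AE_const_imp_const[OF \<Omega>(2)])
       (rule strain_locally_constant[OF assms(1,2) ne \<Omega>(1) _ assms(8) K3])
  then obtain c where c: "AE x in lborel. x \<in> \<Omega> \<longrightarrow> Du x $ 1 $ 1 = c" ..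
  have diag: "sym_part A $ j $ j = A $ j $ j" for A :: "real^3^3" and j
    by (simp add: sym_part_def transpose_def)
  \<comment> \<open>The first component identifies the well, and with it the other two components.\<close>
  define d :: "real^3" where "d = (if c = \<eta>3 then vector [\<eta>3, \<eta>1, \<eta>2]
    else if c = \<eta>2 then vector [\<eta>2, \<eta>3, \<eta>1] else vector [\<eta>1, \<eta>2, \<eta>3])"
  have "AE x in lebesgue_on \<Omega>. sym_part (Du x) $ j $ j = d $ j" for j
    unfolding on_\<Omega> diag using c K3
  proof eventually_elim
    case (elim x)
    show ?case
    proof
      assume "x \<in> \<Omega>"
      then have 1: "Du x $ 1 $ 1 = c"
        and "(Du x $ 1 $ 1, Du x $ 2 $ 2, Du x $ 3 $ 3) \<in> {(\<eta>3, \<eta>1, \<eta>2), (\<eta>2, \<eta>3, \<eta>1), (\<eta>1, \<eta>2, \<eta>3)}"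
        using elim sym_part_in_K3(1) by blast+
      then have "Du x $ 1 $ 1 = d $ 1 \<and> Du x $ 2 $ 2 = d $ 2 \<and> Du x $ 3 $ 3 = d $ 3"
        using assms(1,2) by (auto simp: d_def vector_3)
      then show "Du x $ j $ j = d $ j"
        using exhaust_3[of j] by auto
    qed
  qed
  then show ?thesis by blast
qed

end
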